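(* Let $\rho_0\in C^\infty([0,1])$ satisfy $\min\rho_0>0$ and $\min\rho_0'>0$, and let $0<\sigma<\sigma_c$. For each $\mathbf k=(k_1,k_2)\in\mathcal S$, there are an integer $N\ge1$ and characteristic values $\lambda_1(\mathbf k,\sigma)>\dots>\lambda_N(\mathbf k,\sigma)>0$ such that the linearized equations $$\begin{cases}\partial_t\theta+\rho_0'u_3=0,\\ \rho_0\partial_tu+\nabla q-\mu\Delta u+\sigma(\rho_0'\Delta\theta\, e_3+\rho_0''\nabla\theta)+g\theta e_3=0,\\ \operatorname{div}u=0,\end{cases}\qquad u|_{\partial\Omega}=0,$$ admit (possibly multiple) nontrivial normal mode solutions, $1\le j\le N$, of the form $$\begin{cases}\theta_j(t,x)=e^{\lambda_j(\mathbf k,\sigma)t}\cos(k_1x_1+k_2x_2)\,\eta_j(\mathbf k,\sigma,x_3),\\ u_{1,j}(t,x)=e^{\lambda_j(\mathbf k,\sigma)t}\sin(k_1x_1+k_2x_2)\,v_{1,j}(\mathbf k,\sigma,x_3),\\ u_{2,j}(t,x)=e^{\lambda_j(\mathbf k,\sigma)t}\sin(k_1x_1+k_2x_2)\,v_{2,j}(\mathbf k,\sigma,x_3),\\ u_{3,j}(t,x)=e^{\lambda_j(\mathbf k,\sigma)t}\cos(k_1x_1+k_2x_2)\,\phi_j(\mathbf k,\sigma,x_3),\\ q_j(t,x)=e^{\lambda_j(\mathbf k,\sigma)t}\cos(k_1x_1+k_2x_2)\,\pi_j(\mathbf k,\sigma,x_3),\end{cases}$$ where $\eta_j,v_{1,j},v_{2,j},\phi_j,\pi_j$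 are real-valued smooth functions of $x_3$.
   Context: $I=(0,1)$, $'=d/dx_3$, $\Omega=(2\pi L\mathbf T)^2\times(0,1)$ with $\mathbf T$ the 1D torus and $L>0$ (functions are $2\pi L$-periodic in $x_1,x_2$), $e_3=(0,0,1)^T$, and $g,\mu>0$ are constants. The profile $\rho_0$ depends on $x_3$ only. For $k>0$, $$\sigma_c:=\sup_{0\ne\vartheta\in H_0^1(I)}\frac{g\int_I\rho_0'\vartheta^2}{\int_I(\rho_0')^2(\vartheta')^2},\qquad \sigma_c(k):=\sup_{0\ne\vartheta\in H_0^1(I)}\frac{g\int_I\rho_0'\vartheta^2}{\int_I(\rho_0')^2(k^2\vartheta^2+(\vartheta')^2)},$$ and $\mathcal S:=\{\mathbf k\in(L^{-1}\mathbb Z)^2\setminus\{0\}:\ \sigma<\sigma_c(|\mathbf k|)\}$, $|\mathbf k|=\sqrt{k_1^2+k_2^2}$. With $k=|\mathbf k|$, a characteristic value is a $\lambda\in\mathbb C$ with $\operatorname{Re}\lambda>0$ for which $$\lambda^2(k^2\rho_0\phi-(\rho_0\phi')')+\lambda\mu(\phi^{(4)}-2k^2\phi''+k^4\phi)=gk^2\rho_0'\phi+\sigma k^2((\rho_0')^2\phi')'-\sigma k^4(\rho_0')^2\phi$$ on $(0,1)$ with $\phi=\phi'=0$ at $x_3=0,1$ has a nontrivial solution. *)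

theory Defs
  imports "HOL-Analysis.Analysis"
begin

section \<open>Smooth functions of one variable\<close>

text \<open>Derivatives relative to a set \<open>S\<close>: for \<open>S = {0..1}\<close> they are one-sided at the end points,
  so that \<open>smooth_on {0..1}\<close> is the class of smooth functions up to the boundary. On
  \<open>S\<close> they depend only on the values of \<open>f\<close> on \<open>S\<close>.\<close>

definition deriv_on :: "real set \<Rightarrow> (real \<Rightarrow> 'a::real_normed_vector) \<Rightarrow> real \<Rightarrow> 'a"
  where "deriv_on S f x = vector_derivative f (at x within S)"

definition smooth_on :: "real set \<Rightarrow> (real \<Rightarrow> 'a::real_normed_vector) \<Rightarrow> bool"
  where "smooth_on S f \<longleftrightarrow> (\<forall>n. ((deriv_on S ^^ n) f) differentiable_on S)"

definition C_k_on :: "nat \<Rightarrow> real set \<Rightarrow> (real \<Rightarrow> 'a::real_normed_vector) \<Rightarrow> bool"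
  where "C_k_on m S f \<longleftrightarrow>
    (\<forall>n<m. ((deriv_on S ^^ n) f) differentiable_on S) \<and> continuous_on S ((deriv_on S ^^ m) f)"

abbreviation D01 :: "(real \<Rightarrow> 'a::real_normed_vector) \<Rightarrow> real \<Rightarrow> 'a"
  where "D01 \<equiv> deriv_on {0..1}"

section \<open>The Sobolev space $H_0^1(0,1)$ and the critical numbers\<close>

abbreviation int_I :: "(real \<Rightarrow> real) \<Rightarrow> real"
  where "int_I f \<equiv> integral\<^sup>L (lebesgue_on {0<..<1}) f"

definition test_fun :: "(real \<Rightarrow> real) \<Rightarrow> bool"
  where "test_fun f \<longleftrightarrow> smooth_on UNIV f \<and>
    (\<exists>a b. 0 < a \<and> b < 1 \<and> (\<forall>x. x \<notin> {a..b} \<longrightarrow> f x = 0))"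

definition L2_I :: "(real \<Rightarrow> real) \<Rightarrow> bool"
  where "L2_I v \<longleftrightarrow> v \<in> borel_measurable (lebesgue_on {0<..<1}) \<and>
    integrable (lebesgue_on {0<..<1}) (\<lambda>x. (v x)\<^sup>2)"

text \<open>\<open>H1 v w\<close>: \<open>v\<close> lies in $H^1(I)$ and \<open>w\<close> represents its weak derivative (determined almost
  everywhere by \<open>v\<close>).\<close>

definition H1 :: "(real \<Rightarrow> real) \<Rightarrow> (real \<Rightarrow> real) \<Rightarrow> bool"
  where "H1 v w \<longleftrightarrow> L2_I v \<and> L2_I w \<and>
    (\<forall>\<psi>. test_fun \<psi> \<longrightarrow>
      int_I (\<lambda>x. v x * deriv_on UNIV \<psi> x) = - int_I (\<lambda>x. w x * \<psi> x))"

text \<open>\<open>H01\<close> is the closure of the test functions in the norm of $H^1(I)$; as in \<open>H1\<close>, the second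
  argument represents the weak derivative of the first.\<close>

definition H01 :: "(real \<Rightarrow> real) \<Rightarrow> (real \<Rightarrow> real) \<Rightarrow> bool"
  where "H01 v w \<longleftrightarrow> H1 v w \<and>
    (\<exists>\<psi>. (\<forall>n::nat. test_fun (\<psi> n)) \<and>
      (\<lambda>n. int_I (\<lambda>x. (\<psi> n x - v x)\<^sup>2 + (deriv_on UNIV (\<psi> n) x - w x)\<^sup>2)) \<longlonglongrightarrow> 0)"

definition H01_nonzero :: "(real \<Rightarrow> real) \<Rightarrow> (real \<Rightarrow> real) \<Rightarrow> bool"
  where "H01_nonzero v w \<longleftrightarrow> H01 v w \<and> \<not> (AE x in lebesgue_on {0<..<1}. v x = 0)"

text \<open>The suprema are taken in the extended reals, so no boundedness is presupposed.\<close>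

definition sigma_crit :: "real \<Rightarrow> (real \<Rightarrow> real) \<Rightarrow> ereal"
  where "sigma_crit g \<rho> = Sup {ereal (g * int_I (\<lambda>x. D01 \<rho> x * (v x)\<^sup>2) /
      int_I (\<lambda>x. (D01 \<rho> x)\<^sup>2 * (w x)\<^sup>2)) | v w. H01_nonzero v w}"

definition sigma_crit_k :: "real \<Rightarrow> (real \<Rightarrow> real) \<Rightarrow> real \<Rightarrow> ereal"
  where "sigma_crit_k g \<rho> k = Sup {ereal (g * int_I (\<lambda>x. D01 \<rho> x * (v x)\<^sup>2) /
      int_I (\<lambda>x. (D01 \<rho> x)\<^sup>2 * (k\<^sup>2 * (v x)\<^sup>2 + (w x)\<^sup>2))) | v w. H01_nonzero v w}"

definition unstable_freqs :: "real \<Rightarrow> real \<Rightarrow> real \<Rightarrow> (real \<Rightarrow> real) \<Rightarrow> (real \<times> real) set"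
  where "unstable_freqs L g \<sigma> \<rho> =
    {(k1, k2). (\<exists>m n :: int. k1 = of_int m / L \<and> k2 = of_int n / L) \<and> (k1, k2) \<noteq> (0, 0) \<and>
      ereal \<sigma> < sigma_crit_k g \<rho> (sqrt (k1\<^sup>2 + k2\<^sup>2))}"

section \<open>Characteristic values\<close>

definition char_equation ::
  "real \<Rightarrow> real \<Rightarrow> real \<Rightarrow> (real \<Rightarrow> real) \<Rightarrow> real \<Rightarrow> complex \<Rightarrow> (real \<Rightarrow> complex) \<Rightarrow> real \<Rightarrow> bool"
  where "char_equation g \<mu> \<sigma> \<rho> k lam \<phi> x \<longleftrightarrow>
    lam\<^sup>2 * ((k\<^sup>2 * \<rho> x) *\<^sub>R \<phi> x - D01 (\<lambda>y. \<rho> y *\<^sub>R D01 \<phi> y) x)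
      + lam * (\<mu> *\<^sub>R ((D01 ^^ 4) \<phi> x - (2 * k\<^sup>2) *\<^sub>R (D01 ^^ 2) \<phi> x + (k ^ 4) *\<^sub>R \<phi> x))
    = (g * k\<^sup>2 * D01 \<rho> x) *\<^sub>R \<phi> x
      + (\<sigma> * k\<^sup>2) *\<^sub>R D01 (\<lambda>y. ((D01 \<rho> y)\<^sup>2) *\<^sub>R D01 \<phi> y) x
      - (\<sigma> * k ^ 4 * (D01 \<rho> x)\<^sup>2) *\<^sub>R \<phi> x"

definition char_value ::
  "real \<Rightarrow> real \<Rightarrow> real \<Rightarrow> (real \<Rightarrow> real) \<Rightarrow> real \<Rightarrow> complex \<Rightarrow> bool"
  where "char_value g \<mu> \<sigma> \<rho> k lam \<longleftrightarrow> Re lam > 0 \<and>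
    (\<exists>\<phi> :: real \<Rightarrow> complex. C_k_on 4 {0..1} \<phi> \<and>
      (\<forall>x\<in>{0<..<1}. char_equation g \<mu> \<sigma> \<rho> k lam \<phi> x) \<and>
      \<phi> 0 = 0 \<and> D01 \<phi> 0 = 0 \<and> \<phi> 1 = 0 \<and> D01 \<phi> 1 = 0 \<and>
      (\<exists>x\<in>{0..1}. \<phi> x \<noteq> 0))"

section \<open>The linearized equations\<close>

text \<open>Functions on $\Omega = (2\pi L\mathbf{T})^2\times(0,1)$ are represented by functions on
  $\mathbf{R}^2\times(0,1)$ that are $2\pi L$-periodic in the first two variables.\<close>

definition Omega :: "(real ^ 3) set"
  where "Omega = {x. 0 < x $ 3 \<and> x $ 3 < 1}"

definition Omega_closed :: "(real ^ 3) set"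
  where "Omega_closed = {x. 0 \<le> x $ 3 \<and> x $ 3 \<le> 1}"

definition horizontally_periodic :: "real \<Rightarrow> (real ^ 3 \<Rightarrow> 'a) \<Rightarrow> bool"
  where "horizontally_periodic L f \<longleftrightarrow> (\<forall>x\<in>Omega_closed.
    f (x + axis 1 (2 * pi * L)) = f x \<and> f (x + axis 2 (2 * pi * L)) = f x)"

definition pd :: "3 \<Rightarrow> (real ^ 3 \<Rightarrow> real) \<Rightarrow> real ^ 3 \<Rightarrow> real"
  where "pd i f x = frechet_derivative f (at x) (axis i 1)"

definition grad :: "(real ^ 3 \<Rightarrow> real) \<Rightarrow> real ^ 3 \<Rightarrow> real ^ 3"
  where "grad f x = (\<chi> i. pd i f x)"

definition lapl :: "(real ^ 3 \<Rightarrow> real) \<Rightarrow> real ^ 3 \<Rightarrow> real"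
  where "lapl f x = (\<Sum>i\<in>UNIV. pd i (pd i f) x)"

definition vec_lapl :: "(real ^ 3 \<Rightarrow> real ^ 3) \<Rightarrow> real ^ 3 \<Rightarrow> real ^ 3"
  where "vec_lapl u x = (\<chi> i. lapl (\<lambda>y. u y $ i) x)"

definition diverg :: "(real ^ 3 \<Rightarrow> real ^ 3) \<Rightarrow> real ^ 3 \<Rightarrow> real"
  where "diverg u x = (\<Sum>i\<in>UNIV. pd i (\<lambda>y. u y $ i) x)"

definition twice_diff_on_Omega :: "(real ^ 3 \<Rightarrow> real) \<Rightarrow> bool"
  where "twice_diff_on_Omega f \<longleftrightarrow>
    (\<forall>x\<in>Omega. f differentiable (at x) \<and> (\<forall>i. pd i f differentiable (at x)))"

text \<open>The regularity clauses guarantee that every derivative occurring in the equations exists and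
  that the boundary values of \<open>u\<close> are attained continuously.\<close>

definition linearized_solution ::
  "real \<Rightarrow> real \<Rightarrow> real \<Rightarrow> real \<Rightarrow> (real \<Rightarrow> real) \<Rightarrow>
   (real \<Rightarrow> real ^ 3 \<Rightarrow> real) \<Rightarrow> (real \<Rightarrow> real ^ 3 \<Rightarrow> real ^ 3) \<Rightarrow> (real \<Rightarrow> real ^ 3 \<Rightarrow> real) \<Rightarrow> bool"
  where "linearized_solution L g \<mu> \<sigma> \<rho> \<theta> u q \<longleftrightarrow>
    (\<forall>t. horizontally_periodic L (\<theta> t) \<and> horizontally_periodic L (u t) \<and>
         horizontally_periodic L (q t) \<and>
         twice_diff_on_Omega (\<theta> t) \<and> (\<forall>i. twice_diff_on_Omega (\<lambda>x. u t x $ i)) \<and>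
         (\<forall>x\<in>Omega. q t differentiable (at x)) \<and>
         continuous_on Omega_closed (u t)) \<and>
    (\<forall>t. \<forall>x\<in>Omega.
       (\<lambda>s. \<theta> s x) differentiable (at t) \<and> (\<lambda>s. u s x) differentiable (at t) \<and>
       vector_derivative (\<lambda>s. \<theta> s x) (at t) + D01 \<rho> (x $ 3) * u t x $ 3 = 0 \<and>
       \<rho> (x $ 3) *\<^sub>R vector_derivative (\<lambda>s. u s x) (at t) + grad (q t) x - \<mu> *\<^sub>R vec_lapl (u t) x
         + \<sigma> *\<^sub>R ((D01 \<rho> (x $ 3) * lapl (\<theta> t) x) *\<^sub>R axis 3 1
                 + D01 (D01 \<rho>) (x $ 3) *\<^sub>R grad (\<theta> t) x)
         + (g * \<theta> t x) *\<^sub>R axis 3 1 = 0 \<and>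
       diverg (u t) x = 0) \<and>
    (\<forall>t. \<forall>x\<in>Omega_closed. x $ 3 = 0 \<or> x $ 3 = 1 \<longrightarrow> u t x = 0)"

definition nontrivial_fields ::
  "(real \<Rightarrow> real ^ 3 \<Rightarrow> real) \<Rightarrow> (real \<Rightarrow> real ^ 3 \<Rightarrow> real ^ 3) \<Rightarrow> bool"
  where "nontrivial_fields \<theta> u \<longleftrightarrow> (\<exists>t. \<exists>x\<in>Omega. \<theta> t x \<noteq> 0 \<or> u t x \<noteq> 0)"

end

theory Submission
  imports Defs "HOL-Complex_Analysis.Great_Picard"
begin

text \<open>One growth rate suffices (\<open>N = 1\<close>). For real \<open>\<lambda> > 0\<close> the characteristic equation is the Euler--Lagrange
  equation of the quadratic form
  \<open>Q\<^sub>\<lambda>(\<phi>) = \<integral> \<lambda>\<^sup>2 \<rho> (k\<^sup>2 \<phi>\<^sup>2 + \<phi>'\<^sup>2) + \<lambda> \<mu> (\<phi>''\<^sup>2 + 2 k\<^sup>2 \<phi>'\<^sup>2 + k\<^sup>4 \<phi>\<^sup>2) + \<sigma> k\<^sup>2 \<rho>'\<^sup>2 (\<phi>'\<^sup>2 + k\<^sup>2 \<phi>\<^sup>2) - g k\<^sup>2 \<rho>' \<phi>\<^sup>2\<close>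
  on functions clamped at both ends, and \<open>Q\<^sub>\<lambda>\<close> increases with \<open>\<lambda>\<close>. It takes negative values for small \<open>\<lambda>\<close> because
  \<open>\<sigma> < \<sigma>\<^sub>c(k)\<close>, and it is nonnegative for large \<open>\<lambda>\<close>. At the supremum \<open>\<lambda>\<close> of the parameters with negative values the
  form is nonnegative, and normalised functions \<open>u\<^sub>n\<close> with \<open>Q(u\<^sub>n) < 0\<close> at parameters tending to \<open>\<lambda>\<close> satisfy
  \<open>Q\<^sub>\<lambda>(u\<^sub>n) \<rightarrow> 0\<close> and have second derivatives bounded in the mean square. By Arzela--Ascoli a subsequence
  converges in \<open>C\<^sup>1\<close>, and the Cauchy--Schwarz inequality for \<open>Q\<^sub>\<lambda>\<close> shows that the limit is a nonzero weak solution. A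
  du Bois-Reymond argument makes it \<open>C\<^sup>4\<close>, the equation then makes it smooth, and the remaining fields of the
  normal mode are explicit in \<open>\<phi>\<close>.\<close>

section \<open>Smooth functions on the unit interval\<close>

text \<open>A relation rather than the operator \<open>D01\<close>: it asserts that the derivative
  exists, one-sided at the end points, and it allows any formula for \<open>f'\<close> that is right
  on the interval.\<close>

definition has_D01 :: "(real \<Rightarrow> 'a::real_normed_vector) \<Rightarrow> (real \<Rightarrow> 'a) \<Rightarrow> bool"
  where "has_D01 f f' \<longleftrightarrow> (\<forall>x\<in>{0..1}. (f has_vector_derivative f' x) (at x within {0..1}))"

lemma has_D01_cong:
  assumes "\<And>x. x \<in> {0..1} \<Longrightarrow> f x = g x" "\<And>x. x \<in> {0..1} \<Longrightarrow> f' x = g' x"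
  shows "has_D01 f f' \<longleftrightarrow> has_D01 g g'"
proof -
  have "(f has_vector_derivative f' x) (at x within {0..1}) \<longleftrightarrow>
      (g has_vector_derivative g' x) (at x within {0..1})" if "x \<in> {0..1}" for x
    using that assms by (metis has_vector_derivative_transform)
  then show ?thesis by (simp add: has_D01_def)
qed

lemma has_D01_const: "has_D01 (\<lambda>x. c) (\<lambda>x. 0)"
  by (simp add: has_D01_def)

section \<open>Differentiation rules up to the boundary\<close>

lemma has_D01_add:
  "has_D01 f f' \<Longrightarrow> has_D01 g g' \<Longrightarrow> has_D01 (\<lambda>x. f x + g x) (\<lambda>x. f' x + g' x)"
  by (simp add: has_D01_def has_vector_derivative_add)

lemma has_D01_diff:
  "has_D01 f f' \<Longrightarrow> has_D01 g g' \<Longrightarrow> has_D01 (\<lambda>x. f x - g x) (\<lambda>x. f' x - g' x)"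
  by (simp add: has_D01_def has_vector_derivative_diff)

lemma has_D01_mult:
  fixes f :: "real \<Rightarrow> real"
  shows "has_D01 f f' \<Longrightarrow> has_D01 g g' \<Longrightarrow>
    has_D01 (\<lambda>x. f x * g x) (\<lambda>x. f x * g' x + f' x * g x)"
  by (simp add: has_D01_def has_vector_derivative_mult)

lemma has_D01_cmult:
  fixes f :: "real \<Rightarrow> real"
  shows "has_D01 f f' \<Longrightarrow> has_D01 (\<lambda>x. c * f x) (\<lambda>x. c * f' x)"
  using has_D01_mult[OF has_D01_const[of c]] by simp

lemma has_D01_of_real:
  "has_D01 f f' \<Longrightarrow> has_D01 (\<lambda>x. complex_of_real (f x)) (\<lambda>x. complex_of_real (f' x))"
  by (simp add: has_D01_def bounded_linear.has_vector_derivative[OF bounded_linear_of_real])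

lemma has_D01_continuous: "has_D01 f f' \<Longrightarrow> continuous_on {0..1} f"
  unfolding has_D01_def by (rule continuous_on_vector_derivative) blast

lemma has_D01_differentiable: "has_D01 f f' \<Longrightarrow> f differentiable_on {0..1}"
  by (auto simp: has_D01_def differentiable_on_def intro: differentiableI_vector)

lemma has_D01_at:
  assumes "has_D01 f f'" "0 < x" "x < 1"
  shows "(f has_vector_derivative f' x) (at x)"
proof -
  have "(f has_vector_derivative f' x) (at x within {0..1})"
    using assms by (simp add: has_D01_def)
  moreover have "at x within {0..1} = at x"
    using assms by (intro at_within_interior) auto
  ultimately show ?thesis by simp
qed

text \<open>The interval is nondegenerate, so derivatives within it are unique even at 0 and 1, and
  the value chosen by \<open>vector_derivative\<close> must be the known one.\<close>

lemma D01_eq: "has_D01 f f' \<Longrightarrow> x \<in> {0..1} \<Longrightarrow> D01 f x = f' x"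
  using vector_derivative_within_cbox[of 0 1 x f "f' x"] by (simp add: deriv_on_def has_D01_def)

lemma D01_cong:
  assumes "\<And>y. y \<in> {0..1} \<Longrightarrow> f y = g y" "x \<in> {0..1}"
  shows "D01 f x = D01 g x"
proof -
  have "(f has_vector_derivative d) (at x within {0..1}) \<longleftrightarrow>
      (g has_vector_derivative d) (at x within {0..1})" for d
    using assms by (metis has_vector_derivative_transform)
  then show ?thesis by (simp add: deriv_on_def vector_derivative_def)
qed

text \<open>The class C^n([0,1]). Recursion through some derivative \<open>f'\<close>, instead of
  iterates of \<open>D01\<close>, makes the closure properties direct inductions;
  \<open>smooth_onI\<close> and \<open>C_k_onI\<close> lead back to the iterates.\<close>

primrec Cn :: "nat \<Rightarrow> (real \<Rightarrow> 'a::real_normed_vector) \<Rightarrow> bool" where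
  "Cn 0 f \<longleftrightarrow> continuous_on {0..1} f"
| "Cn (Suc n) f \<longleftrightarrow> (\<exists>f'. has_D01 f f' \<and> Cn n f')"

lemma Cn_cong:
  assumes "\<And>x. x \<in> {0..1} \<Longrightarrow> f x = g x"
  shows "Cn n f \<longleftrightarrow> Cn n g"
proof (cases n)
  case 0
  then show ?thesis using continuous_on_cong[OF refl, of "{0..1}" f g] assms by simp
next
  case (Suc m)
  then show ?thesis using has_D01_cong[of f g] assms by (metis Cn.simps(2))
qed

lemma Cn_SucD: "Cn (Suc n) f \<Longrightarrow> Cn n f"
proof (induction n arbitrary: f)
  case 0
  then show ?case by (auto intro: has_D01_continuous)
next
  case (Suc n)
  then show ?case by (metis Cn.simps(2))
qed

lemma Cn_D01:
  assumes "Cn (Suc n) f"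
  shows "Cn n (D01 f)"
proof -
  from assms obtain f' where "has_D01 f f'" "Cn n f'" by auto
  then show ?thesis using Cn_cong[of "D01 f" f' n] by (simp add: D01_eq)
qed

lemma Cn_differentiable: "Cn (Suc n) f \<Longrightarrow> f differentiable_on {0..1}"
  by (auto intro: has_D01_differentiable)

lemma Cn_funpow: "Cn (n + m) f \<Longrightarrow> Cn m ((D01 ^^ n) f)"
proof (induction n arbitrary: m)
  case (Suc n)
  have "Cn (Suc m) ((D01 ^^ n) f)"
    by (rule Suc.IH) (use Suc.prems in \<open>simp only: add_Suc_right add_Suc\<close>)
  then show ?case using Cn_D01[of m "(D01 ^^ n) f"] by (simp only: funpow.simps o_apply)
qed simp

lemma smooth_onI:
  assumes "\<And>n. Cn n f"
  shows "smooth_on {0..1} f"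
  unfolding smooth_on_def using assms Cn_differentiable Cn_funpow by blast

lemma C_k_onI:
  assumes "Cn m f"
  shows "C_k_on m {0..1} f"
  unfolding C_k_on_def
proof (intro conjI allI impI)
  fix n assume "n < m"
  then have "n + Suc (m - Suc n) = m" by simp
  then have "Cn (n + Suc (m - Suc n)) f" using assms by metis
  then show "(D01 ^^ n) f differentiable_on {0..1}"
    using Cn_differentiable Cn_funpow by blast
next
  show "continuous_on {0..1} ((D01 ^^ m) f)"
    using Cn_funpow[of m 0 f] assms by simp
qed

lemma smooth_on_deriv: "smooth_on S f \<Longrightarrow> smooth_on S (deriv_on S f)"
  unfolding smooth_on_def by (metis funpow_Suc_right o_apply)

lemma smooth_on_has_vector_derivative:
  assumes "smooth_on S f" "x \<in> S"
  shows "(f has_vector_derivative deriv_on S f x) (at x within S)"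
proof -
  have "f differentiable_on S"
    using assms(1) unfolding smooth_on_def by (metis funpow_0)
  then show ?thesis
    using assms(2) by (simp add: deriv_on_def differentiable_on_def vector_derivative_works)
qed

lemma smooth_on_continuous: "smooth_on S f \<Longrightarrow> continuous_on S f"
  unfolding smooth_on_def by (metis funpow_0 differentiable_imp_continuous_on)

lemma smooth_on_has_D01: "smooth_on {0..1} f \<Longrightarrow> has_D01 f (D01 f)"
  by (simp add: has_D01_def smooth_on_has_vector_derivative)

lemma smooth_on_Cn: "smooth_on {0..1} f \<Longrightarrow> Cn n f"
proof (induction n arbitrary: f)
  case 0
  then show ?case by (simp add: smooth_on_continuous)
next
  case (Suc n)
  then show ?case using smooth_on_has_D01 smooth_on_deriv Cn.simps(2) by blast
qed

section \<open>Closure of the classes C^n under algebraic operations\<close>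

lemma Cn_const: "Cn n (\<lambda>x. c)"
proof (induction n arbitrary: c)
  case (Suc n)
  then show ?case using has_D01_const Cn.simps(2) by blast
qed simp

lemma Cn_add: "Cn n f \<Longrightarrow> Cn n g \<Longrightarrow> Cn n (\<lambda>x. f x + g x)"
proof (induction n arbitrary: f g)
  case 0
  then show ?case by (simp add: continuous_on_add)
next
  case (Suc n)
  then obtain f' g' where "has_D01 f f'" "Cn n f'" "has_D01 g g'" "Cn n g'"
    by (auto simp only: Cn.simps)
  then show ?case using Suc.IH has_D01_add Cn.simps(2) by blast
qed

lemma Cn_mult:
  fixes f g :: "real \<Rightarrow> real"
  shows "Cn n f \<Longrightarrow> Cn n g \<Longrightarrow> Cn n (\<lambda>x. f x * g x)"
proof (induction n arbitrary: f g)
  case 0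
  then show ?case by (simp add: continuous_on_mult)
next
  case (Suc n)
  then obtain f' g' where *: "has_D01 f f'" "Cn n f'" "has_D01 g g'" "Cn n g'"
    by (auto simp only: Cn.simps)
  have "Cn n (\<lambda>x. f x * g' x + f' x * g x)"
    using Suc.prems * by (intro Cn_add Suc.IH) (auto intro: Cn_SucD simp del: Cn.simps)
  then show ?case using has_D01_mult[OF *(1,3)] Cn.simps(2) by blast
qed

lemma Cn_cmult:
  fixes f :: "real \<Rightarrow> real"
  shows "Cn n f \<Longrightarrow> Cn n (\<lambda>x. c * f x)"
  by (rule Cn_mult[OF Cn_const])

lemma Cn_diff:
  fixes f g :: "real \<Rightarrow> real"
  assumes "Cn n f" "Cn n g"
  shows "Cn n (\<lambda>x. f x - g x)"
  using Cn_add[OF assms(1) Cn_cmult[OF assms(2), of "-1"]] by simp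

lemma Cn_of_real: "Cn n f \<Longrightarrow> Cn n (\<lambda>x. complex_of_real (f x))"
proof (induction n arbitrary: f)
  case 0
  then show ?case by (simp add: continuous_on_of_real)
next
  case (Suc n)
  then obtain f' where "has_D01 f f'" "Cn n f'"
    by (auto simp only: Cn.simps)
  then show ?case using Suc.IH has_D01_of_real Cn.simps(2) by blast
qed

section \<open>Quadratic forms on clamped functions\<close>

lemma has_D01_integral:
  fixes f :: "real \<Rightarrow> real"
  assumes "continuous_on {0..1} f"
  shows "has_D01 (\<lambda>x. integral {0..x} f) f"
  using integral_has_vector_derivative[OF assms] by (simp add: has_D01_def)

lemma has_integral_D01:
  fixes f :: "real \<Rightarrow> real"
  assumes "has_D01 f f'" "0 \<le> x" "x \<le> y" "y \<le> 1"
  shows "(f' has_integral f y - f x) {x..y}"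
proof (rule fundamental_theorem_of_calculus)
  fix z assume "z \<in> {x..y}"
  then show "(f has_vector_derivative f' z) (at z within {x..y})"
    using assms unfolding has_D01_def
    by (intro has_vector_derivative_within_subset[of f "f' z" z "{0..1}" "{x..y}"]) auto
qed (use assms in simp)

lemma integral_D01:
  fixes f :: "real \<Rightarrow> real"
  assumes "has_D01 f f'"
  shows "integral {0..1} f' = f 1 - f 0"
  using has_integral_D01[OF assms, of 0 1] by (simp add: integral_unique)

lemma integral_lincomb:
  fixes f g h :: "real \<Rightarrow> real"
  assumes "f integrable_on S" "g integrable_on S" "h integrable_on S"
  shows "integral S (\<lambda>x. f x + s * g x + r * h x) = integral S f + s * integral S g + r * integral S h"
  by (intro integral_unique has_integral_add has_integral_mult_right integrable_integral assms)

text \<open>The Cauchy-Schwarz inequality against the constant 1, read off from the nonnegative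
  integral of \<open>(f - m)^2\<close> with \<open>m\<close> the mean of \<open>f\<close> over
  \<open>{x..y}\<close>. Applied to second derivatives it gives Hoelder continuity of first
  derivatives with exponent 1/2.\<close>

lemma integral_square_bound:
  fixes f :: "real \<Rightarrow> real"
  assumes "continuous_on {0..1} f" "0 \<le> x" "x \<le> y" "y \<le> 1"
  shows "(integral {x..y} f)\<^sup>2 \<le> (y - x) * integral {0..1} (\<lambda>t. (f t)\<^sup>2)"
proof (cases "x = y")
  case True
  then show ?thesis by simp
next
  case False
  have sub: "{x..y} \<subseteq> {0..1}" using assms by auto
  have c: "continuous_on {x..y} f" using continuous_on_subset[OF assms(1) sub] .
  define d where "d = y - x"
  have d: "d > 0" using False assms by (simp add: d_def)
  define m where "m = integral {x..y} f / d"
  have m: "integral {x..y} f = m * d" using d by (simp add: m_def)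
  have "0 \<le> integral {x..y} (\<lambda>t. (f t - m)\<^sup>2)"
    by (intro integral_nonneg integrable_continuous_real continuous_intros c) auto
  also have "(\<lambda>t. (f t - m)\<^sup>2) = (\<lambda>t. (f t)\<^sup>2 + (- 2 * m) * f t + m\<^sup>2 * 1)"
    by (auto simp: power2_eq_square algebra_simps)
  also have "integral {x..y} \<dots> = integral {x..y} (\<lambda>t. (f t)\<^sup>2) - m\<^sup>2 * d"
    using assms d by (subst integral_lincomb)
      (auto intro!: integrable_continuous_real continuous_intros c simp: m d_def power2_eq_square)
  finally have "m\<^sup>2 * d * d \<le> integral {x..y} (\<lambda>t. (f t)\<^sup>2) * d"
    using d by (intro mult_right_mono) auto
  then have "(integral {x..y} f)\<^sup>2 \<le> d * integral {x..y} (\<lambda>t. (f t)\<^sup>2)"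
    by (simp add: m power2_eq_square mult_ac)
  also have "integral {x..y} (\<lambda>t. (f t)\<^sup>2) \<le> integral {0..1} (\<lambda>t. (f t)\<^sup>2)"
    by (intro integral_subset_le integrable_continuous_real continuous_intros c assms sub) auto
  finally show ?thesis using d by (simp add: d_def mult_left_mono)
qed

text \<open>A classical stand-in for the Sobolev space of order two with vanishing trace and normal
  derivative. It is not complete; limits of minimising sequences are only known to be C^1 at first
  and are treated as weak solutions.\<close>

definition clamped :: "(real \<Rightarrow> real) \<Rightarrow> bool"
  where "clamped f \<longleftrightarrow> Cn 2 f \<and> f 0 = 0 \<and> f 1 = 0 \<and> D01 f 0 = 0 \<and> D01 f 1 = 0"

text \<open>The symmetric bilinear form of the operator \<open>c f'''' - (a f')' + b f\<close> under
  clamped boundary conditions.\<close>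

definition form :: "real \<Rightarrow> (real \<Rightarrow> real) \<Rightarrow> (real \<Rightarrow> real) \<Rightarrow> (real \<Rightarrow> real) \<Rightarrow> (real \<Rightarrow> real) \<Rightarrow> real"
  where "form c a b f g = integral {0..1} (\<lambda>x. c * (D01 (D01 f) x * D01 (D01 g) x)
    + a x * (D01 f x * D01 g x) + b x * (f x * g x))"

lemma Cn_has_D01:
  assumes "Cn (Suc n) f"
  shows "has_D01 f (D01 f)"
proof -
  from assms obtain f' where f: "has_D01 f f'" by auto
  then show ?thesis using has_D01_cong[of f f "D01 f" f'] D01_eq[OF f] by simp
qed

lemma clampedD:
  assumes "clamped f"
  shows "has_D01 f (D01 f)" "has_D01 (D01 f) (D01 (D01 f))"
    "continuous_on {0..1} f" "continuous_on {0..1} (D01 f)" "continuous_on {0..1} (D01 (D01 f))"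
    "f 0 = 0" "f 1 = 0" "D01 f 0 = 0" "D01 f 1 = 0"
proof -
  have C2: "Cn (Suc (Suc 0)) f" using assms by (simp only: clamped_def numeral_2_eq_2)
  show 1: "has_D01 f (D01 f)" using Cn_has_D01[OF C2] .
  show 2: "has_D01 (D01 f) (D01 (D01 f))" using Cn_has_D01[OF Cn_D01[OF C2]] .
  show "continuous_on {0..1} f" "continuous_on {0..1} (D01 f)"
    using 1 2 has_D01_continuous by blast+
  show "continuous_on {0..1} (D01 (D01 f))" using Cn_D01[OF Cn_D01[OF C2]] by simp
qed (use assms in \<open>auto simp: clamped_def\<close>)

lemma clampedI:
  assumes "has_D01 f f1" "has_D01 f1 f2" "continuous_on {0..1} f2"
    "f 0 = 0" "f 1 = 0" "f1 0 = 0" "f1 1 = 0"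
  shows "clamped f"
proof -
  have "Cn (Suc (Suc 0)) f" using assms by auto
  then show ?thesis using assms D01_eq[OF assms(1)] by (simp add: clamped_def numeral_2_eq_2)
qed

lemma D01_D01_eq:
  assumes "has_D01 f f1" "has_D01 f1 f2" "x \<in> {0..1}"
  shows "D01 (D01 f) x = f2 x"
proof -
  have "has_D01 (D01 f) f2"
    using assms has_D01_cong[of "D01 f" f1 f2 f2] D01_eq[OF assms(1)] by simp
  then show ?thesis using assms(3) by (rule D01_eq)
qed

section \<open>Algebra and order of the energy forms\<close>

lemma clamped_add_scaled:
  assumes "clamped f" "clamped g"
  shows "clamped (\<lambda>x. f x + t * g x)"
    and "x \<in> {0..1} \<Longrightarrow> D01 (\<lambda>x. f x + t * g x) x = D01 f x + t * D01 g x"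
    and "x \<in> {0..1} \<Longrightarrow> D01 (D01 (\<lambda>x. f x + t * g x)) x = D01 (D01 f) x + t * D01 (D01 g) x"
proof -
  note d = has_D01_add[OF clampedD(1)[OF assms(1)] has_D01_cmult[OF clampedD(1)[OF assms(2)], of t]]
    has_D01_add[OF clampedD(2)[OF assms(1)] has_D01_cmult[OF clampedD(2)[OF assms(2)], of t]]
  show "clamped (\<lambda>x. f x + t * g x)"
    by (rule clampedI[OF d]) (simp_all add: clampedD[OF assms(1)] clampedD[OF assms(2)]
        continuous_on_mult_left continuous_on_add)
  show "x \<in> {0..1} \<Longrightarrow> D01 (\<lambda>x. f x + t * g x) x = D01 f x + t * D01 g x"
    by (rule D01_eq[OF d(1)])
  show "x \<in> {0..1} \<Longrightarrow> D01 (D01 (\<lambda>x. f x + t * g x)) x = D01 (D01 f) x + t * D01 (D01 g) x"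
    by (rule D01_D01_eq[OF d])
qed

lemma form_continuous:
  assumes "clamped f" "clamped g" "continuous_on {0..1} a" "continuous_on {0..1} b"
  shows "continuous_on {0..1} (\<lambda>x. c * (D01 (D01 f) x * D01 (D01 g) x)
    + a x * (D01 f x * D01 g x) + b x * (f x * g x))"
  by (intro continuous_intros clampedD(3-5)[OF assms(1)] clampedD(3-5)[OF assms(2)] assms(3,4))

lemma form_add_scaled:
  assumes "clamped f" "clamped g" "continuous_on {0..1} a" "continuous_on {0..1} b"
  shows "form c a b (\<lambda>x. f x + t * g x) (\<lambda>x. f x + t * g x)
    = form c a b f f + 2 * t * form c a b f g + t\<^sup>2 * form c a b g g"
proof -
  let ?q = "\<lambda>f g x. c * (D01 (D01 f) x * D01 (D01 g) x) + a x * (D01 f x * D01 g x) + b x * (f x * g x)"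
  have i: "?q f f integrable_on {0..1}" "?q f g integrable_on {0..1}" "?q g g integrable_on {0..1}"
    by (intro integrable_continuous_real form_continuous assms)+
  have "form c a b (\<lambda>x. f x + t * g x) (\<lambda>x. f x + t * g x)
      = integral {0..1} (\<lambda>x. ?q f f x + 2 * t * ?q f g x + t\<^sup>2 * ?q g g x)"
    unfolding form_def
    by (rule integral_cong) (simp add: clamped_add_scaled[OF assms(1,2)] power2_eq_square algebra_simps)
  also have "\<dots> = form c a b f f + 2 * t * form c a b f g + t\<^sup>2 * form c a b g g"
    unfolding form_def by (rule integral_lincomb[OF i])
  finally show ?thesis .
qed

text \<open>Nonnegativity of the form at \<open>f + t g\<close> for one well chosen
  \<open>t\<close>. The summand 1 avoids a separate treatment of \<open>form c a b g g = 0\<close>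
  and is harmless, since only the factor belonging to \<open>f\<close> has to tend to zero
  later.\<close>

lemma form_Cauchy_Schwarz:
  assumes nonneg: "\<And>f. clamped f \<Longrightarrow> 0 \<le> form c a b f f"
    and "clamped f" "clamped g" "continuous_on {0..1} a" "continuous_on {0..1} b"
  shows "(form c a b f g)\<^sup>2 \<le> form c a b f f * (form c a b g g + 1)"
proof -
  let ?F = "form c a b f f" and ?B = "form c a b f g" and ?G = "form c a b g g"
  have G: "0 \<le> ?G" using nonneg assms by simp
  \<comment> \<open>The minimiser of the quadratic in \<open>t\<close> is \<open>- ?B / ?G\<close>;
    the denominator is enlarged by 1 so that it cannot vanish.\<close>
  define t where "t = - ?B / (?G + 1)"
  have tB: "?B = - t * (?G + 1)" using G by (simp add: t_def)
  have "0 \<le> ?F + 2 * t * ?B + t\<^sup>2 * ?G"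
    using nonneg[OF clamped_add_scaled(1)[OF assms(2,3)], of t] form_add_scaled[OF assms(2-5), of c t]
    by simp
  also have "\<dots> = ?F - t\<^sup>2 * (?G + 2)"
    unfolding tB by (simp add: power2_eq_square algebra_simps)
  also have "\<dots> \<le> ?F - t\<^sup>2 * (?G + 1)"
    by (simp add: mult_left_mono)
  finally have "t\<^sup>2 * (?G + 1) * (?G + 1) \<le> ?F * (?G + 1)"
    using G by (intro mult_right_mono) auto
  then show ?thesis
    unfolding tB by (simp add: power2_eq_square algebra_simps)
qed

lemma form_mono:
  assumes "clamped f" "continuous_on {0..1} a" "continuous_on {0..1} b"
    "continuous_on {0..1} a'" "continuous_on {0..1} b'"
    "c \<le> c'" "\<And>x. x \<in> {0..1} \<Longrightarrow> a x \<le> a' x" "\<And>x. x \<in> {0..1} \<Longrightarrow> b x \<le> b' x"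
  shows "form c a b f f \<le> form c' a' b' f f"
  unfolding form_def
proof (rule integral_le)
  fix x :: real assume x: "x \<in> {0..1}"
  show "c * (D01 (D01 f) x * D01 (D01 f) x) + a x * (D01 f x * D01 f x) + b x * (f x * f x)
    \<le> c' * (D01 (D01 f) x * D01 (D01 f) x) + a' x * (D01 f x * D01 f x) + b' x * (f x * f x)"
    using assms(6) assms(7,8)[OF x] by (intro add_mono mult_right_mono) auto
qed (intro integrable_continuous_real form_continuous assms)+

lemma form_scale:
  assumes "clamped f"
  shows "clamped (\<lambda>x. s * f x)" "form c a b (\<lambda>x. s * f x) (\<lambda>x. s * f x) = s\<^sup>2 * form c a b f f"
proof -
  note d = has_D01_cmult[OF clampedD(1)[OF assms], of s] has_D01_cmult[OF clampedD(2)[OF assms], of s]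
  show "clamped (\<lambda>x. s * f x)"
    by (rule clampedI[OF d]) (simp_all add: clampedD[OF assms] continuous_on_mult_left)
  have "form c a b (\<lambda>x. s * f x) (\<lambda>x. s * f x)
    = integral {0..1} (\<lambda>x. s\<^sup>2 * (c * (D01 (D01 f) x * D01 (D01 f) x)
       + a x * (D01 f x * D01 f x) + b x * (f x * f x)))"
    unfolding form_def
    by (rule integral_cong) (simp add: D01_eq[OF d(1)] D01_D01_eq[OF d] power2_eq_square algebra_simps)
  then show "form c a b (\<lambda>x. s * f x) (\<lambda>x. s * f x) = s\<^sup>2 * form c a b f f"
    by (simp add: form_def)
qed

section \<open>Regularity and compactness\<close>

lemma integral_add_cmult:
  fixes f g :: "real \<Rightarrow> real"
  assumes "continuous_on {0..1} f" "continuous_on {0..1} g"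
  shows "integral {0..1} (\<lambda>x. f x + s * g x) = integral {0..1} f + s * integral {0..1} g"
  by (intro integral_unique has_integral_add has_integral_mult_right integrable_integral
      integrable_continuous_real assms)

text \<open>Moving all derivatives onto the test function turns the weak equation into orthogonality of a continuous \<open>G\<close> to
  the third derivatives of clamped functions. These are exactly the continuous functions orthogonal to
  \<open>p(x) = x (1 - x)\<close>, so \<open>G\<close> is a multiple of \<open>p\<close>.\<close>

lemma weak_solution_regularity:
  fixes a a' b \<phi> h :: "real \<Rightarrow> real"
  assumes c: "c \<noteq> 0"
    and h: "has_D01 \<phi> h" "continuous_on {0..1} h" "\<phi> 0 = 0" "\<phi> 1 = 0" "h 0 = 0" "h 1 = 0"
    and a: "has_D01 a a'" and b: "continuous_on {0..1} b"
    and weak: "\<And>\<psi> \<psi>1 \<psi>2 \<psi>3. \<lbrakk>has_D01 \<psi> \<psi>1; has_D01 \<psi>1 \<psi>2; has_D01 \<psi>2 \<psi>3; continuous_on {0..1} \<psi>3;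
      \<psi> 0 = 0; \<psi> 1 = 0; \<psi>1 0 = 0; \<psi>1 1 = 0\<rbrakk> \<Longrightarrow>
      integral {0..1} (\<lambda>x. - c * h x * \<psi>3 x + a x * h x * \<psi>1 x + b x * \<phi> x * \<psi> x) = 0"
  obtains h1 h2 h3 where "has_D01 h h1" "has_D01 h1 h2" "has_D01 h2 h3"
    "\<And>x. x \<in> {0..1} \<Longrightarrow> c * h3 x = a' x * h x + a x * h1 x - b x * \<phi> x"
proof -
  have cont_a: "continuous_on {0..1} a" and cont_\<phi>: "continuous_on {0..1} \<phi>"
    using a h(1) by (auto intro: has_D01_continuous)
  \<comment> \<open>Three integrations by parts move everything to \<psi>3:
    \<open>b \<phi> \<psi>\<close> becomes \<open>- B \<psi>1\<close>, then
    \<open>E0 \<psi>1\<close> becomes \<open>- E \<psi>2\<close>, and this becomes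
    \<open>F \<psi>3\<close>.\<close>
  define B where "B x = integral {0..x} (\<lambda>x. b x * \<phi> x)" for x
  have B: "has_D01 B (\<lambda>x. b x * \<phi> x)"
    unfolding B_def[abs_def] by (intro has_D01_integral continuous_intros b cont_\<phi>)
  define E0 where "E0 x = a x * h x - B x" for x
  have E0_cont: "continuous_on {0..1} E0"
    unfolding E0_def[abs_def] by (intro continuous_intros cont_a h has_D01_continuous[OF B])
  define E1 where "E1 x = integral {0..x} E0" for x
  have E1: "has_D01 E1 E0"
    unfolding E1_def[abs_def] by (intro has_D01_integral E0_cont)
  \<comment> \<open>\<psi>2 has mean zero, so the primitive may be shifted by a constant. This
    choice makes \<open>F\<close> vanish at both ends, where \<psi>2 is not prescribed.\<close>
  define E where "E x = E1 x - integral {0..1} E1" for x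
  have E: "has_D01 E E0"
    using has_D01_diff[OF E1 has_D01_const[of "integral {0..1} E1"]] by (simp add: E_def[abs_def])
  have E_cont: "continuous_on {0..1} E" using has_D01_continuous[OF E] .
  define F where "F x = integral {0..x} E" for x
  have F: "has_D01 F E"
    unfolding F_def[abs_def] by (intro has_D01_integral E_cont)
  have F0: "F 0 = 0" by (simp add: F_def)
  have F1: "F 1 = 0"
    unfolding F_def E_def
    by (subst integral_diff) (auto intro: integrable_continuous_real has_D01_continuous[OF E1])
  define G where "G x = F x - c * h x" for x
  have G_cont: "continuous_on {0..1} G"
    unfolding G_def[abs_def] by (intro continuous_intros h has_D01_continuous[OF F])
  have G: "integral {0..1} (\<lambda>x. G x * \<psi>3 x) = 0"
    if \<psi>: "has_D01 \<psi> \<psi>1" "has_D01 \<psi>1 \<psi>2" "has_D01 \<psi>2 \<psi>3" "continuous_on {0..1} \<psi>3"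
      "\<psi> 0 = 0" "\<psi> 1 = 0" "\<psi>1 0 = 0" "\<psi>1 1 = 0" for \<psi> \<psi>1 \<psi>2 \<psi>3
  proof -
    have c\<psi>: "continuous_on {0..1} \<psi>" "continuous_on {0..1} \<psi>1" "continuous_on {0..1} \<psi>2"
      using \<psi> by (auto intro: has_D01_continuous)
    \<comment> \<open>The function whose increment collects the boundary terms of all three
      integrations by parts; it vanishes at 0 and 1 because \<psi>, \<psi>1 and \<open>F\<close>
      do.\<close>
    have "has_D01 (\<lambda>x. B x * \<psi> x + E x * \<psi>1 x - F x * \<psi>2 x)
       (\<lambda>x. (B x * \<psi>1 x + b x * \<phi> x * \<psi> x) + (E x * \<psi>2 x + E0 x * \<psi>1 x) - (F x * \<psi>3 x + E x * \<psi>2 x))"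
      by (intro has_D01_diff has_D01_add has_D01_mult B E F \<psi>)
    from integral_D01[OF this]
    have "integral {0..1} (\<lambda>x. (B x * \<psi>1 x + b x * \<phi> x * \<psi> x) + (E x * \<psi>2 x + E0 x * \<psi>1 x)
        - (F x * \<psi>3 x + E x * \<psi>2 x)) = 0"
      using \<psi> F0 F1 by simp
    moreover have "(\<lambda>x. G x * \<psi>3 x) = (\<lambda>x. (- c * h x * \<psi>3 x + a x * h x * \<psi>1 x + b x * \<phi> x * \<psi> x)
        + (- 1) * ((B x * \<psi>1 x + b x * \<phi> x * \<psi> x) + (E x * \<psi>2 x + E0 x * \<psi>1 x)
        - (F x * \<psi>3 x + E x * \<psi>2 x)))"
      by (auto simp: G_def E0_def algebra_simps)
    then have "integral {0..1} (\<lambda>x. G x * \<psi>3 x)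
      = integral {0..1} (\<lambda>x. - c * h x * \<psi>3 x + a x * h x * \<psi>1 x + b x * \<phi> x * \<psi> x)
        + (- 1) * integral {0..1} (\<lambda>x. (B x * \<psi>1 x + b x * \<phi> x * \<psi> x) + (E x * \<psi>2 x + E0 x * \<psi>1 x)
        - (F x * \<psi>3 x + E x * \<psi>2 x))"
      by (simp only:) (intro integral_add_cmult continuous_intros b c\<psi> \<psi>(4)
        cont_a cont_\<phi> h(2) E_cont E0_cont has_D01_continuous[OF B] has_D01_continuous[OF F])
    ultimately show ?thesis using weak[OF \<psi>] by simp
  qed
  define p where "p x = x * (1 - x)" for x :: real
  have D: "has_D01 q q'" if "\<And>x. (q has_real_derivative q' x) (at x)" for q q' :: "real \<Rightarrow> real"
    using that by (simp add: has_D01_def has_field_derivative_at_within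
        flip: has_real_derivative_iff_has_vector_derivative)
  have p: "has_D01 p (\<lambda>x. 1 - 2 * x)" "has_D01 (\<lambda>x. 1 - 2 * x) (\<lambda>x. - 2 :: real)"
    by (rule D; auto simp: p_def[abs_def] intro!: derivative_eq_intros)+
  have p_cont: "continuous_on {0..1} p" using has_D01_continuous[OF p(1)] .
  have p2: "integral {0..1} (\<lambda>x. p x * p x) = 1 / 30"
  proof -
    have "has_D01 (\<lambda>x. x ^ 3 / 3 - x ^ 4 / 2 + x ^ 5 / 5) (\<lambda>x :: real. p x * p x)"
      by (rule D) (auto simp: p_def power2_eq_square power3_eq_cube power4_eq_xxxx algebra_simps
          intro!: derivative_eq_intros)
    from integral_D01[OF this] show ?thesis by simp
  qed
  \<comment> \<open>The factor 30 is the reciprocal of the integral of \<open>p^2\<close>, so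
    \<open>H\<close> is the part of \<open>G\<close> orthogonal to \<open>p\<close>.\<close>
  define \<kappa> where "\<kappa> = 30 * integral {0..1} (\<lambda>x. p x * G x)"
  define H where "H x = G x - \<kappa> * p x" for x
  have H_cont: "continuous_on {0..1} H"
    unfolding H_def[abs_def] by (intro continuous_intros G_cont p_cont)
  have pH: "integral {0..1} (\<lambda>x. p x * H x) = 0"
  proof -
    have "(\<lambda>x. p x * H x) = (\<lambda>x. p x * G x + (- \<kappa>) * (p x * p x))"
      by (auto simp: H_def algebra_simps)
    then have "integral {0..1} (\<lambda>x. p x * H x) = integral {0..1} (\<lambda>x. p x * G x)
      + (- \<kappa>) * integral {0..1} (\<lambda>x. p x * p x)"
      by (simp only:) (intro integral_add_cmult continuous_intros p_cont G_cont)
    then show ?thesis by (simp add: p2 \<kappa>_def)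
  qed
  \<comment> \<open>\<open>H\<close> is integrated three times to a test function. The constant in
    \<psi>2 secures \<psi>1(1) = 0; the remaining condition \<psi>(1) = 0 will come from
    orthogonality to \<open>p\<close>.\<close>
  define I where "I x = integral {0..x} H" for x
  have I: "has_D01 I H" unfolding I_def[abs_def] by (intro has_D01_integral H_cont)
  define \<psi>2 where "\<psi>2 x = I x - integral {0..1} I" for x
  have \<psi>2: "has_D01 \<psi>2 H"
    using has_D01_diff[OF I has_D01_const[of "integral {0..1} I"]] by (simp add: \<psi>2_def[abs_def])
  define \<psi>1 where "\<psi>1 x = integral {0..x} \<psi>2" for x
  have \<psi>1: "has_D01 \<psi>1 \<psi>2"
    unfolding \<psi>1_def[abs_def] by (intro has_D01_integral has_D01_continuous[OF \<psi>2])
  define \<psi> where "\<psi> x = integral {0..x} \<psi>1" for x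
  have \<psi>: "has_D01 \<psi> \<psi>1"
    unfolding \<psi>_def[abs_def] by (intro has_D01_integral has_D01_continuous[OF \<psi>1])
  have z: "\<psi> 0 = 0" "\<psi>1 0 = 0" by (simp_all add: \<psi>_def \<psi>1_def)
  have \<psi>11: "\<psi>1 1 = 0"
    unfolding \<psi>1_def \<psi>2_def
    by (subst integral_diff) (auto intro: integrable_continuous_real has_D01_continuous[OF I])
  \<comment> \<open>Since \<open>p'' = -2\<close>, the derivative of
    \<open>p \<psi>2 - p' \<psi>1\<close> is \<open>p H + 2 \<psi>1\<close>, and the boundary values
    vanish. Hence \<psi>(1), the integral of \<psi>1, is zero.\<close>
  have "has_D01 (\<lambda>x. p x * \<psi>2 x - (1 - 2 * x) * \<psi>1 x)
      (\<lambda>x. (p x * H x + (1 - 2 * x) * \<psi>2 x) - ((1 - 2 * x) * \<psi>2 x + (- 2) * \<psi>1 x))"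
    by (intro has_D01_diff has_D01_mult p \<psi>1 \<psi>2)
  from integral_D01[OF this]
  have "integral {0..1} (\<lambda>x. p x * H x + 2 * \<psi>1 x) = 0"
    using z \<psi>11 by (simp add: p_def)
  moreover have "integral {0..1} (\<lambda>x. p x * H x + 2 * \<psi>1 x) =
      integral {0..1} (\<lambda>x. p x * H x) + 2 * integral {0..1} \<psi>1"
    by (intro integral_add_cmult continuous_intros p_cont H_cont
        has_D01_continuous[OF \<psi>1])
  ultimately have \<psi>1': "\<psi> 1 = 0" by (simp add: pH \<psi>_def)
  have GH: "integral {0..1} (\<lambda>x. G x * H x) = 0"
    by (rule G[OF \<psi> \<psi>1 \<psi>2 H_cont z(1) \<psi>1' z(2) \<psi>11])
  \<comment> \<open>\<open>H\<close> is orthogonal to \<open>G\<close> and to \<open>p\<close>,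
    hence to itself.\<close>
  have "integral {0..1} (\<lambda>x. H x * H x) = 0"
  proof -
    have "(\<lambda>x. H x * H x) = (\<lambda>x. G x * H x + (- \<kappa>) * (p x * H x))"
      by (auto simp: H_def algebra_simps)
    then have "integral {0..1} (\<lambda>x. H x * H x) = integral {0..1} (\<lambda>x. G x * H x)
      + (- \<kappa>) * integral {0..1} (\<lambda>x. p x * H x)"
      by (simp only:) (intro integral_add_cmult continuous_intros p_cont H_cont G_cont)
    then show ?thesis by (simp add: GH pH)
  qed
  moreover have "continuous_on {0..1} (\<lambda>x. H x * H x)"
    by (intro continuous_intros H_cont)
  ultimately have H0: "H x = 0" if "x \<in> {0..1}" for x
    using that integral_eq_0_iff[of 0 1 "\<lambda>x. H x * H x"] by simp
  \<comment> \<open>Bootstrapping: this formula gives \<open>h\<close> two derivatives, with second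
    derivative built from \<open>E0 = a h - B\<close>; as \<open>h\<close> is now differentiable, so
    is \<open>E0\<close>, which yields the third.\<close>
  have hF: "h x = (1 / c) * (F x - \<kappa> * p x)" if "x \<in> {0..1}" for x
  proof -
    have "c * h x = F x - \<kappa> * p x"
      using H0[OF that] unfolding H_def G_def by linarith
    then show ?thesis using c by (simp add: nonzero_eq_divide_eq mult.commute)
  qed
  define h1 where "h1 x = (1 / c) * (E x - \<kappa> * (1 - 2 * x))" for x
  define h2 where "h2 x = (1 / c) * (E0 x - \<kappa> * (- 2))" for x
  have "has_D01 (\<lambda>x. (1 / c) * (F x - \<kappa> * p x)) h1"
    unfolding h1_def[abs_def] by (intro has_D01_cmult has_D01_diff F p)
  then have h1: "has_D01 h h1"
    using has_D01_cong[of h "\<lambda>x. (1 / c) * (F x - \<kappa> * p x)" h1 h1] hF by simp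
  have h2: "has_D01 h1 h2"
    unfolding h1_def[abs_def] h2_def[abs_def] by (intro has_D01_cmult has_D01_diff E p)
  define h3 where "h3 x = (1 / c) * ((a x * h1 x + a' x * h x) - b x * \<phi> x - \<kappa> * 0)" for x
  have h3: "has_D01 h2 h3"
    unfolding h2_def[abs_def] h3_def[abs_def] E0_def[abs_def]
    by (intro has_D01_cmult has_D01_diff has_D01_mult a h1 B has_D01_const)
  show thesis
    by (rule that[OF h1 h2 h3]) (use c in \<open>simp add: h3_def\<close>)
qed

text \<open>The bound on second derivatives makes the first derivatives uniformly Hoelder
  continuous, and their zero at 0 makes them uniformly bounded. Arzela-Ascoli applies to the
  derivatives, and the functions follow by integration from 0.\<close>

lemma compactness:
  assumes u: "\<And>n::nat. clamped (u n)"
    and C: "\<And>n. integral {0..1} (\<lambda>x. (D01 (D01 (u n)) x)\<^sup>2) \<le> C"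
  obtains r \<phi> h where "strict_mono (r :: nat \<Rightarrow> nat)" "has_D01 \<phi> h" "continuous_on {0..1} h"
    "\<phi> 0 = 0" "\<phi> 1 = 0" "h 0 = 0" "h 1 = 0"
    "uniform_limit {0..1} (\<lambda>n. u (r n)) \<phi> sequentially"
    "uniform_limit {0..1} (\<lambda>n. D01 (u (r n))) h sequentially"
proof -
  have "0 \<le> integral {0..1} (\<lambda>x. (D01 (D01 (u 0)) x)\<^sup>2)"
    by (rule Henstock_Kurzweil_Integration.integral_nonneg) (intro integrable_continuous_real continuous_intros clampedD(5)[OF u], simp)
  then have C0: "0 \<le> C" using C[of 0] by linarith
  have le: "(D01 (u n) y - D01 (u n) x)\<^sup>2 \<le> (y - x) * C" if "0 \<le> x" "x \<le> y" "y \<le> 1" for n x y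
  proof -
    have "D01 (u n) y - D01 (u n) x = integral {x..y} (D01 (D01 (u n)))"
      using has_integral_D01[OF clampedD(2)[OF u[of n]] that] by (simp add: integral_unique)
    also have "\<dots>\<^sup>2 \<le> (y - x) * integral {0..1} (\<lambda>x. (D01 (D01 (u n)) x)\<^sup>2)"
      by (rule integral_square_bound[OF clampedD(5)[OF u] that])
    also have "\<dots> \<le> (y - x) * C" using that by (intro mult_left_mono C) auto
    finally show ?thesis .
  qed
  have abs_le: "(D01 (u n) x - D01 (u n) y)\<^sup>2 \<le> \<bar>x - y\<bar> * C" if "x \<in> {0..1}" "y \<in> {0..1}" for n x y
    using le[of x y n] le[of y x n] that
    by (cases "x \<le> y") (auto simp: power2_commute)
  obtain h r where h: "continuous_on {0..1} h" "strict_mono (r :: nat \<Rightarrow> nat)"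
    "\<And>e. 0 < e \<Longrightarrow> \<exists>N. \<forall>n x. n \<ge> N \<and> x \<in> {0..1} \<longrightarrow> norm (D01 (u (r n)) x - h x) < e"
  proof (rule Arzela_Ascoli[of "{0..1::real}" "\<lambda>n. D01 (u n)" "C + 1"])
    show "norm (D01 (u n) x) \<le> C + 1" if "x \<in> {0..1}" for n x
    proof -
      have "(D01 (u n) x)\<^sup>2 \<le> \<bar>x\<bar> * C"
        using abs_le[of x 0 n] that clampedD(8)[OF u] by simp
      also have "\<dots> \<le> 1 * C" using that C0 by (intro mult_right_mono) auto
      also have "\<dots> \<le> (C + 1)\<^sup>2" using C0 by (simp add: power2_eq_square algebra_simps)
      finally show ?thesis using C0 abs_le_square_iff[of "D01 (u n) x" "C + 1"] by simp
    qed
    show "\<exists>d>0. \<forall>n y. y \<in> {0..1} \<and> norm (x - y) < d \<longrightarrow> norm (D01 (u n) x - D01 (u n) y) < e"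
      if "x \<in> {0..1}" "0 < e" for x e
    \<comment> \<open>The squared increment is at most \<open>C\<close> times the distance;
      \<open>C + 1\<close> keeps the quotient defined when \<open>C = 0\<close>.\<close>
    proof (intro exI[of _ "e\<^sup>2 / (C + 1)"] conjI allI impI)
      show "0 < e\<^sup>2 / (C + 1)" using that C0 by simp
      fix n y assume y: "y \<in> {0..1} \<and> norm (x - y) < e\<^sup>2 / (C + 1)"
      have "(D01 (u n) x - D01 (u n) y)\<^sup>2 \<le> \<bar>x - y\<bar> * C"
        using abs_le y that by blast
      also have "\<dots> \<le> \<bar>x - y\<bar> * (C + 1)" by (intro mult_left_mono) auto
      also have "\<dots> < e\<^sup>2" using y C0 by (simp add: field_simps)
      finally show "norm (D01 (u n) x - D01 (u n) y) < e"
        using that(2) abs_le_square_iff[of e "D01 (u n) x - D01 (u n) y"] by auto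
    qed
  qed auto
  have U1: "uniform_limit {0..1} (\<lambda>n. D01 (u (r n))) h sequentially"
    unfolding uniform_limit_sequentially_iff dist_real_def using h(3) by (simp add: Ball_def) blast
  define \<phi> where "\<phi> x = integral {0..x} h" for x
  have \<phi>: "has_D01 \<phi> h" unfolding \<phi>_def[abs_def] by (intro has_D01_integral h(1))
  have ui: "u n x = integral {0..x} (D01 (u n))" if "x \<in> {0..1}" for n x
    using has_integral_D01[OF clampedD(1)[OF u], of 0 x n] clampedD(6)[OF u, of n] that
    by (simp add: integral_unique)
  have U0: "uniform_limit {0..1} (\<lambda>n. u (r n)) \<phi> sequentially"
    unfolding uniform_limit_sequentially_iff dist_real_def
  proof (intro allI impI)
    fix e :: real assume "0 < e"
    then obtain N where N: "\<And>n x. n \<ge> N \<Longrightarrow> x \<in> {0..1} \<Longrightarrow> norm (D01 (u (r n)) x - h x) < e / 2"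
      using h(3)[of "e / 2"] by auto
    show "\<exists>N. \<forall>n\<ge>N. \<forall>x\<in>{0..1}. \<bar>u (r n) x - \<phi> x\<bar> < e"
    proof (intro exI[of _ N] allI impI ballI)
      fix n x assume n: "N \<le> n" and x: "x \<in> {0..1::real}"
      have sub: "{0..x} \<subseteq> {0..1}" using x by auto
      have i: "D01 (u (r n)) integrable_on {0..x}" "h integrable_on {0..x}"
        using continuous_on_subset[OF _ sub] h(1) clampedD(4)[OF u]
        by (auto intro: integrable_continuous_real)
      have "u (r n) x - \<phi> x = integral {0..x} (\<lambda>t. D01 (u (r n)) t - h t)"
        using i by (simp add: ui[OF x] \<phi>_def integral_diff)
      also have "norm \<dots> \<le> e / 2 * (x - 0)"
      proof (rule integral_bound)
        show "continuous_on {0..x} (\<lambda>t. D01 (u (r n)) t - h t)"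
          by (intro continuous_intros continuous_on_subset[OF h(1) sub]
              continuous_on_subset[OF clampedD(4)[OF u] sub])
        show "norm (D01 (u (r n)) t - h t) \<le> e / 2" if "t \<in> {0..x}" for t
          using N[OF n, of t] that x by auto
      qed (use x in auto)
      also have "\<dots> \<le> e / 2 * 1" using x \<open>0 < e\<close> by (intro mult_left_mono) auto
      also have "\<dots> < e" using \<open>0 < e\<close> by simp
      finally show "\<bar>u (r n) x - \<phi> x\<bar> < e" by simp
    qed
  qed
  have "h x = 0" if "x = 0 \<or> x = 1" for x
  proof -
    have "(\<lambda>n. D01 (u (r n)) x) \<longlonglongrightarrow> h x"
      using tendsto_uniform_limitI[OF U1] that by auto
    moreover have "D01 (u (r n)) x = 0" for n using that clampedD(8,9)[OF u] by auto
    ultimately show ?thesis by (simp add: LIMSEQ_const_iff)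
  qed
  moreover have "(\<lambda>n. u (r n) 1) \<longlonglongrightarrow> \<phi> 1"
    using tendsto_uniform_limitI[OF U0] by auto
  then have "\<phi> 1 = 0" using clampedD(7)[OF u] by (simp add: LIMSEQ_const_iff)
  moreover have "\<phi> 0 = 0" by (simp add: \<phi>_def)
  ultimately show thesis using that h \<phi> U0 U1 by blast
qed

section \<open>The critical growth rate\<close>

lemma form_nonneg:
  assumes "clamped f" "continuous_on {0..1} a" "continuous_on {0..1} b"
    "0 \<le> c" "\<And>x. x \<in> {0..1} \<Longrightarrow> 0 \<le> a x" "\<And>x. x \<in> {0..1} \<Longrightarrow> 0 \<le> b x"
  shows "0 \<le> form c a b f f"
  unfolding form_def
proof (rule Henstock_Kurzweil_Integration.integral_nonneg)
  show "0 \<le> c * (D01 (D01 f) x * D01 (D01 f) x) + a x * (D01 f x * D01 f x) + b x * (f x * f x)"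
    if "x \<in> {0..1}" for x
    using assms(4-6) that by simp
qed (intro integrable_continuous_real form_continuous assms)

lemma form_lincomb:
  assumes "clamped f" and
    a: "continuous_on {0..1} a0" "continuous_on {0..1} a1" "continuous_on {0..1} a2" and
    b: "continuous_on {0..1} b0" "continuous_on {0..1} b1" "continuous_on {0..1} b2"
  shows "form (c0 + s * c1 + r * c2) (\<lambda>x. a0 x + s * a1 x + r * a2 x) (\<lambda>x. b0 x + s * b1 x + r * b2 x) f f
    = form c0 a0 b0 f f + s * form c1 a1 b1 f f + r * form c2 a2 b2 f f"
proof -
  let ?q = "\<lambda>c a b x. c * (D01 (D01 f) x * D01 (D01 f) x) + a x * (D01 f x * D01 f x) + b x * (f x * f x)"
  have "form (c0 + s * c1 + r * c2) (\<lambda>x. a0 x + s * a1 x + r * a2 x) (\<lambda>x. b0 x + s * b1 x + r * b2 x) f f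
      = integral {0..1} (\<lambda>x. ?q c0 a0 b0 x + s * ?q c1 a1 b1 x + r * ?q c2 a2 b2 x)"
    unfolding form_def by (rule integral_cong) (simp add: algebra_simps)
  also have "\<dots> = form c0 a0 b0 f f + s * form c1 a1 b1 f f + r * form c2 a2 b2 f f"
    unfolding form_def by (intro integral_lincomb integrable_continuous_real form_continuous assms)
  finally show ?thesis .
qed

lemma tendsto_integral_uniform_limit:
  fixes f :: "nat \<Rightarrow> real \<Rightarrow> real"
  assumes "uniform_limit {0..1} f g sequentially" "\<And>n. continuous_on {0..1} (f n)"
  shows "(\<lambda>n. integral {0..1} (f n)) \<longlonglongrightarrow> integral {0..1} g"
proof -
  obtain I J where "\<And>n. (f n has_integral I n) {0..1}" "(g has_integral J) {0..1}" "I \<longlonglongrightarrow> J"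
    by (rule uniform_limit_integral[OF assms]) auto
  then show ?thesis by (metis (no_types, lifting) ext integral_unique)
qed

text \<open>Second derivatives of \<open>u n\<close> need not converge, so one derivative is shifted
  to \<psi>. Only the C^1 limit then enters, and no boundary term arises because the first
  derivatives of \<open>u n\<close> vanish at both ends.\<close>

lemma form_weak_limit:
  assumes u: "\<And>n::nat. clamped (u n)" and h: "continuous_on {0..1} h" "continuous_on {0..1} \<phi>"
    and U: "uniform_limit {0..1} u \<phi> sequentially" "uniform_limit {0..1} (\<lambda>n. D01 (u n)) h sequentially"
    and ab: "continuous_on {0..1} a" "continuous_on {0..1} b"
    and \<psi>: "has_D01 \<psi> \<psi>1" "has_D01 \<psi>1 \<psi>2" "has_D01 \<psi>2 \<psi>3" "continuous_on {0..1} \<psi>3"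
  shows "(\<lambda>n. form c a b (u n) \<psi>) \<longlonglongrightarrow>
    integral {0..1} (\<lambda>x. - c * h x * \<psi>3 x + a x * h x * \<psi>1 x + b x * \<phi> x * \<psi> x)"
proof -
  have c\<psi>: "continuous_on {0..1} \<psi>" "continuous_on {0..1} \<psi>1" "continuous_on {0..1} \<psi>2"
    using \<psi> by (auto intro: has_D01_continuous)
  let ?W = "\<lambda>v w x. (a x * \<psi>1 x - c * \<psi>3 x) * w x + (b x * \<psi> x) * v x"
  have by_parts: "form c a b (u n) \<psi> = integral {0..1} (?W (u n) (D01 (u n)))" for n
  proof -
    note un = clampedD[OF u[of n]]
    have "has_D01 (\<lambda>x. D01 (u n) x * \<psi>2 x) (\<lambda>x. D01 (u n) x * \<psi>3 x + D01 (D01 (u n)) x * \<psi>2 x)"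
      by (intro has_D01_mult un \<psi>)
    from integral_D01[OF this]
    have z: "integral {0..1} (\<lambda>x. D01 (u n) x * \<psi>3 x + D01 (D01 (u n)) x * \<psi>2 x) = 0"
      by (simp add: un)
    have "form c a b (u n) \<psi> = integral {0..1} (\<lambda>x. ?W (u n) (D01 (u n)) x
        + c * (D01 (u n) x * \<psi>3 x + D01 (D01 (u n)) x * \<psi>2 x))"
      unfolding form_def
      by (rule integral_cong) (simp add: D01_eq[OF \<psi>(1)] D01_D01_eq[OF \<psi>(1,2)] algebra_simps)
    also have "\<dots> = integral {0..1} (?W (u n) (D01 (u n)))
        + c * integral {0..1} (\<lambda>x. D01 (u n) x * \<psi>3 x + D01 (D01 (u n)) x * \<psi>2 x)"
      by (intro integral_add_cmult continuous_intros ab c\<psi> \<psi>(4) un(3-5))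
    finally show ?thesis by (simp add: z)
  qed
  have bd: "bounded (f ` {0..1})" if "continuous_on {0..1} f" for f :: "real \<Rightarrow> real"
    using that by (intro compact_imp_bounded compact_continuous_image) auto
  have "uniform_limit {0..1} (\<lambda>n. ?W (u n) (D01 (u n))) (?W \<phi> h) sequentially"
    by (intro uniform_limit_add uniform_lim_mult uniform_limit_const U bd continuous_intros ab c\<psi> \<psi>(4) h)
  then have "(\<lambda>n. integral {0..1} (?W (u n) (D01 (u n)))) \<longlonglongrightarrow> integral {0..1} (?W \<phi> h)"
    by (rule tendsto_integral_uniform_limit) (intro continuous_intros ab c\<psi> \<psi>(4) clampedD(3,4)[OF u])
  moreover have "?W \<phi> h = (\<lambda>x. - c * h x * \<psi>3 x + a x * h x * \<psi>1 x + b x * \<phi> x * \<psi> x)"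
    by (auto simp: algebra_simps)
  ultimately show ?thesis by (simp add: by_parts)
qed

text \<open>Continuity in \<open>l\<close>. It is used at 0 to find a parameter with negative
  energy, and at the supremum of such parameters to exclude negative energy there.\<close>

lemma quadratic_neg_right:
  fixes R D T s :: real
  assumes "T + s\<^sup>2 * R + s * D < 0"
  obtains l where "l > s" "T + l\<^sup>2 * R + l * D < 0"
proof -
  have "((\<lambda>l. T + l\<^sup>2 * R + l * D) \<longlongrightarrow> T + s\<^sup>2 * R + s * D) (at_right s)"
    by (intro tendsto_intros)
  then have "\<forall>\<^sub>F l in at_right s. T + l\<^sup>2 * R + l * D < 0"
    using assms by (rule order_tendstoD(2))
  then have "\<forall>\<^sub>F l in at_right s. l > s \<and> T + l\<^sup>2 * R + l * D < 0"
    using eventually_at_right_less by (rule eventually_conj[rotated])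
  then have "\<exists>l. l > s \<and> T + l\<^sup>2 * R + l * D < 0"
    by (rule eventually_happens'[rotated]) simp
  then show thesis using that by blast
qed

text \<open>In the application \<open>P\<close> is \<sigma> k^2 \<rho>'^2 and \<open>S\<close> is g
  k^2 \<rho>' - \<sigma> k^4 \<rho>'^2. The equation is concluded in the weak form that
  \<open>weak_solution_regularity\<close> accepts, with only one derivative on \<phi>.\<close>

lemma critical_parameter:
  fixes \<rho> P S f0 :: "real \<Rightarrow> real" and k \<mu> :: real
  assumes cont: "continuous_on {0..1} \<rho>" "continuous_on {0..1} P" "continuous_on {0..1} S"
    and \<rho>: "\<And>x. x \<in> {0..1} \<Longrightarrow> 0 < \<rho> x" and P: "\<And>x. x \<in> {0..1} \<Longrightarrow> 0 \<le> P x"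
    and \<mu>: "0 < \<mu>" and k: "k \<noteq> 0"
    and f0: "clamped f0" "form 0 P (\<lambda>x. - S x) f0 f0 < 0"
  obtains l \<phi> h where "0 < l" "has_D01 \<phi> h" "continuous_on {0..1} h"
    "\<phi> 0 = 0" "\<phi> 1 = 0" "h 0 = 0" "h 1 = 0" "\<exists>x\<in>{0..1}. \<phi> x \<noteq> 0"
    "\<And>\<psi> \<psi>1 \<psi>2 \<psi>3. \<lbrakk>has_D01 \<psi> \<psi>1; has_D01 \<psi>1 \<psi>2; has_D01 \<psi>2 \<psi>3; continuous_on {0..1} \<psi>3;
      \<psi> 0 = 0; \<psi> 1 = 0; \<psi>1 0 = 0; \<psi>1 1 = 0\<rbrakk> \<Longrightarrow>
      integral {0..1} (\<lambda>x. - (l * \<mu>) * h x * \<psi>3 x + (P x + l\<^sup>2 * \<rho> x + l * (2 * \<mu> * k\<^sup>2)) * h x * \<psi>1 x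
        + (- S x + l\<^sup>2 * (k\<^sup>2 * \<rho> x) + l * (\<mu> * k ^ 4)) * \<phi> x * \<psi> x) = 0"
proof -
  \<comment> \<open>Inertial part \<open>R\<close>, viscous part \<open>D\<close> and the part
    \<open>T\<close> free of \<open>l\<close>: the form \<open>Q l\<close> is the polynomial
    \<open>T + l^2 R + l D\<close>, with \<open>R\<close> and \<open>D\<close> nonnegative on
    clamped functions.\<close>
  define R where "R f = form 0 \<rho> (\<lambda>x. k\<^sup>2 * \<rho> x) f f" for f
  define D where "D f = form \<mu> (\<lambda>x. 2 * \<mu> * k\<^sup>2) (\<lambda>x. \<mu> * k ^ 4) f f" for f
  define T where "T f = form 0 P (\<lambda>x. - S x) f f" for f
  define N where "N f = integral {0..1} (\<lambda>x. f x * f x)" for f :: "real \<Rightarrow> real"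
  define a where "a l x = P x + l\<^sup>2 * \<rho> x + l * (2 * \<mu> * k\<^sup>2)" for l x
  define b where "b l x = - S x + l\<^sup>2 * (k\<^sup>2 * \<rho> x) + l * (\<mu> * k ^ 4)" for l x
  define Q where "Q l f = form (l * \<mu>) (a l) (b l) f f" for l f
  have cont_ab: "continuous_on {0..1} (a l)" "continuous_on {0..1} (b l)" for l
    unfolding a_def[abs_def] b_def[abs_def] by (intro continuous_intros cont)+
  have Q: "Q l f = T f + l\<^sup>2 * R f + l * D f" if "clamped f" for l f
    using form_lincomb[OF that cont(2) cont(1) continuous_on_const[of _ "2 * \<mu> * k\<^sup>2"]
        continuous_on_minus[OF cont(3)] continuous_on_mult_left[OF cont(1), of "k\<^sup>2"]
        continuous_on_const[of _ "\<mu> * k ^ 4"], of 0 "l\<^sup>2" 0 l \<mu>]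
    by (simp add: Q_def T_def R_def D_def a_def[abs_def] b_def[abs_def])
  have ex: "\<exists>x\<in>{0..1}. \<forall>y\<in>{0..1}. f x \<le> f y" if "continuous_on {0..1} f" for f :: "real \<Rightarrow> real"
    using that by (intro continuous_attains_inf) auto
  obtain m where m: "0 < m" "\<And>x. x \<in> {0..1} \<Longrightarrow> m \<le> \<rho> x"
    using ex[OF cont(1)] \<rho> by metis
  obtain M where M: "0 < M" "\<And>x. x \<in> {0..1} \<Longrightarrow> S x \<le> M"
  proof -
    obtain x0 where "\<forall>y\<in>{0..1}. - S x0 \<le> - S y"
      using ex[OF continuous_on_minus[OF cont(3)]] by auto
    then show thesis using that[of "\<bar>S x0\<bar> + 1"] by fastforce
  qed
  have N_form: "form 0 (\<lambda>x. 0) (\<lambda>x. s) f f = s * N f" for s f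
    by (simp add: form_def N_def)
  have R_ge: "k\<^sup>2 * m * N f \<le> R f" if "clamped f" for f
    unfolding N_form[symmetric] R_def using \<rho>
    by (intro form_mono[OF that] continuous_intros cont) (simp_all add: less_imp_le m(2) mult_left_mono)
  have T_ge: "- M * N f \<le> T f" if "clamped f" for f
    unfolding N_form[symmetric] T_def using M P
    by (intro form_mono[OF that] continuous_intros cont) auto
  have D_ge: "\<mu> * integral {0..1} (\<lambda>x. (D01 (D01 f) x)\<^sup>2) \<le> D f" if "clamped f" for f
  proof -
    have "\<mu> * integral {0..1} (\<lambda>x. (D01 (D01 f) x)\<^sup>2) = form \<mu> (\<lambda>x. 0) (\<lambda>x. 0) f f"
      by (simp add: form_def power2_eq_square)
    also have "\<dots> \<le> D f" unfolding D_def using \<mu>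
      by (intro form_mono[OF that] continuous_intros) auto
    finally show ?thesis .
  qed
  have R0: "0 \<le> R f" if "clamped f" for f
    unfolding R_def using \<rho> by (intro form_nonneg[OF that] continuous_intros cont) (auto simp: less_imp_le)
  have D0: "0 \<le> D f" if "clamped f" for f
    unfolding D_def using \<mu> by (intro form_nonneg[OF that] continuous_intros) auto
  have N0: "0 \<le> N f" if "clamped f" for f
    unfolding N_def using clampedD(3)[OF that]
    by (intro Henstock_Kurzweil_Integration.integral_nonneg integrable_continuous_real continuous_intros) auto
  \<comment> \<open>From \<open>T \<ge> - M N\<close>, \<open>R \<ge> k^2 m N\<close> and
    \<open>D \<ge> 0\<close>: negative energy forces a nonzero function, which can be normalised,
    and bounds \<open>l\<close> from above.\<close>
  have neg: "N f > 0 \<and> l\<^sup>2 * (k\<^sup>2 * m) < M" if "clamped f" "0 < l" "Q l f < 0" for f l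
  proof -
    have "- M * N f + l\<^sup>2 * (k\<^sup>2 * m * N f) \<le> T f + l\<^sup>2 * R f + l * D f"
    proof -
      have "l\<^sup>2 * (k\<^sup>2 * m * N f) \<le> l\<^sup>2 * R f"
        using R_ge[OF that(1)] by (rule mult_left_mono) simp
      moreover have "0 \<le> l * D f" using D0[OF that(1)] that(2) by simp
      ultimately show ?thesis using T_ge[OF that(1)] by linarith
    qed
    then have *: "N f * (l\<^sup>2 * (k\<^sup>2 * m) - M) < 0"
      using Q[OF that(1)] that(3) by (simp add: algebra_simps)
    then have "N f \<noteq> 0" by auto
    then have "N f > 0" using N0[OF that(1)] by simp
    with * show ?thesis by (simp add: mult_less_0_iff)
  qed
  define A where "A = {l. 0 < l \<and> (\<exists>f. clamped f \<and> Q l f < 0)}"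
  obtain l0 where l0: "l0 \<in> A"
  proof -
    \<comment> \<open>At \<open>l = 0\<close> the energy of \<open>f0\<close> is
      \<open>T f0 < 0\<close>, and it stays negative for some positive \<open>l\<close>.\<close>
    obtain l where "l > 0" "T f0 + l\<^sup>2 * R f0 + l * D f0 < 0"
      using quadratic_neg_right[of "T f0" 0 "R f0" "D f0"] f0(2) by (auto simp: T_def)
    then have "l \<in> A" using f0(1) Q[OF f0(1), of l] unfolding A_def by auto
    then show thesis by (rule that)
  qed
  have bdd: "bdd_above A"
  proof
    fix l assume "l \<in> A"
    then have "0 < l" "l\<^sup>2 * (k\<^sup>2 * m) < M" using neg by (auto simp: A_def)
    then have "l\<^sup>2 < M / (k\<^sup>2 * m)" using m k by (simp add: pos_less_divide_eq)
    \<comment> \<open>Turns the bound on \<open>l^2\<close> into one on \<open>l\<close> without a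
      square root.\<close>
    moreover have "2 * l \<le> l\<^sup>2 + 1" using zero_le_power2[of "l - 1"] by (simp add: power2_diff)
    ultimately show "l \<le> (M / (k\<^sup>2 * m) + 1) / 2" by simp
  qed
  define s where "s = Sup A"
  have s: "0 < s" using cSup_upper[OF l0 bdd] l0 by (auto simp: s_def A_def)
  \<comment> \<open>Otherwise negativity would persist at some parameter beyond the
    supremum.\<close>
  have Qs: "0 \<le> Q s f" if f: "clamped f" for f
  proof (rule ccontr)
    assume "\<not> 0 \<le> Q s f"
    then obtain l where "l > s" "T f + l\<^sup>2 * R f + l * D f < 0"
      using quadratic_neg_right[of "T f" s "R f" "D f"] Q[OF f] by auto
    then have "l \<in> A" using f Q[OF f, of l] s unfolding A_def by auto
    then have "l \<le> s" unfolding s_def by (rule cSup_upper[OF _ bdd])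
    with \<open>l > s\<close> show False by simp
  qed
  \<comment> \<open>The bound \<open>s / 2\<close> keeps the parameters away from 0, which makes
    \<open>R (u n)\<close> and \<open>D (u n)\<close> bounded uniformly in \<open>n\<close>; the
    second bound makes the parameters tend to \<open>s\<close>.\<close>
  have "\<exists>l u. s / 2 \<le> l \<and> s - inverse (real (Suc n)) < l \<and> l \<le> s \<and> clamped u \<and> Q l u < 0 \<and> N u = 1" for n
  proof -
    have "max (s / 2) (s - inverse (real (Suc n))) < Sup A"
      using s by (simp add: s_def)
    then obtain l where l: "l \<in> A" "max (s / 2) (s - inverse (real (Suc n))) < l"
      using less_cSupD[of A] l0 by blast
    then obtain f where f: "0 < l" "clamped f" "Q l f < 0" by (auto simp: A_def)
    then have Nf: "0 < N f" using neg by blast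
    obtain t where t: "t\<^sup>2 * N f = 1" "0 < t\<^sup>2"
      by (rule that[of "1 / sqrt (N f)"]) (use Nf in \<open>simp_all add: power_divide\<close>)
    have "Q l (\<lambda>x. t * f x) < 0"
      using form_scale(2)[OF f(2)] mult_pos_neg[OF t(2) f(3)] by (simp add: Q_def)
    moreover have "N (\<lambda>x. t * f x) = 1"
      using form_scale(2)[OF f(2), of 0 "\<lambda>x. 0" "\<lambda>x. 1" t] t(1) by (simp add: form_def N_def)
    moreover have "l \<le> s" unfolding s_def by (rule cSup_upper[OF l(1) bdd])
    ultimately show ?thesis using l(2) form_scale(1)[OF f(2), of t]
      by (intro exI[of _ l] exI[of _ "\<lambda>x. t * f x"]) auto
  qed
  then obtain l u where lu: "\<And>n. s / 2 \<le> l n" "\<And>n. s - inverse (real (Suc n)) < l n" "\<And>n. l n \<le> s"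
    "\<And>n. clamped (u n)" "\<And>n. Q (l n) (u n) < 0" "\<And>n. N (u n) = 1"
    by metis
  have l_pos: "0 < l n" for n using lu(1)[of n] s by simp
  have RD: "(s / 2)\<^sup>2 * R (u n) \<le> M" "s / 2 * D (u n) \<le> M" for n
  proof -
    have *: "(l n)\<^sup>2 * R (u n) + l n * D (u n) \<le> M"
      using lu(5)[of n] Q[OF lu(4)[of n]] T_ge[OF lu(4)[of n]] lu(6)[of n] by simp
    have "(s / 2)\<^sup>2 * R (u n) \<le> (l n)\<^sup>2 * R (u n)"
      using lu(1)[of n] s by (intro mult_right_mono power_mono R0 lu) auto
    moreover have "s / 2 * D (u n) \<le> l n * D (u n)"
      by (intro mult_right_mono D0 lu)
    moreover have "0 \<le> (l n)\<^sup>2 * R (u n)" "0 \<le> l n * D (u n)"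
      using R0[OF lu(4)] D0[OF lu(4)] l_pos[of n] by simp_all
    ultimately show "(s / 2)\<^sup>2 * R (u n) \<le> M" "s / 2 * D (u n) \<le> M" using * by linarith+
  qed
  \<comment> \<open>\<open>Q s - Q l = (s - l) ((s + l) R + D)\<close> because \<open>T\<close>
    cancels, and \<open>K\<close> dominates the last factor along the sequence.\<close>
  define K where "K = 2 * s * (M / (s / 2)\<^sup>2) + M / (s / 2)"
  have Q_le: "Q s (u n) \<le> inverse (real (Suc n)) * K" for n
  proof -
    have "R (u n) \<le> M / (s / 2)\<^sup>2" "D (u n) \<le> M / (s / 2)"
      using RD[of n] s by (simp_all add: pos_le_divide_eq mult.commute)
    then have RDK: "2 * s * R (u n) + D (u n) \<le> K"
      unfolding K_def using s by (intro add_mono mult_left_mono) auto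
    have "Q s (u n) = Q (l n) (u n) + (s - l n) * ((s + l n) * R (u n) + D (u n))"
      by (simp add: Q[OF lu(4)] power2_eq_square algebra_simps)
    also have "\<dots> \<le> (s - l n) * ((s + l n) * R (u n) + D (u n))"
      using lu(5)[of n] by simp
    also have "\<dots> \<le> (s - l n) * (2 * s * R (u n) + D (u n))"
      using lu(3)[of n] R0[OF lu(4)[of n]] by (intro mult_left_mono add_right_mono mult_right_mono) auto
    also have "\<dots> \<le> (s - l n) * K"
      using lu(3)[of n] RDK by (intro mult_left_mono) auto
    also have "\<dots> \<le> inverse (real (Suc n)) * K"
      using lu(2)[of n] M s by (intro mult_right_mono) (auto simp: K_def)
    finally show ?thesis .
  qed
  have Q_lim: "(\<lambda>n. Q s (u n)) \<longlonglongrightarrow> 0"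
  proof (rule tendsto_sandwich)
    show "\<forall>\<^sub>F n in sequentially. 0 \<le> Q s (u n)" using Qs lu(4) by simp
    show "\<forall>\<^sub>F n in sequentially. Q s (u n) \<le> inverse (real (Suc n)) * K" using Q_le by simp
    show "(\<lambda>n. inverse (real (Suc n)) * K) \<longlonglongrightarrow> 0"
      using tendsto_mult_left_zero[OF LIMSEQ_inverse_real_of_nat] .
  qed simp
  have "integral {0..1} (\<lambda>x. (D01 (D01 (u n)) x)\<^sup>2) \<le> 2 * M / (s * \<mu>)" for n
  proof -
    have "s / 2 * (\<mu> * integral {0..1} (\<lambda>x. (D01 (D01 (u n)) x)\<^sup>2)) \<le> M"
      using mult_left_mono[OF D_ge[OF lu(4)[of n]], of "s / 2"] RD(2)[of n] s by linarith
    then show ?thesis using s \<mu> by (simp add: pos_le_divide_eq mult_ac)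
  qed
  then obtain r \<phi> h where r: "strict_mono (r :: nat \<Rightarrow> nat)"
    and h: "has_D01 \<phi> h" "continuous_on {0..1} h" "\<phi> 0 = 0" "\<phi> 1 = 0" "h 0 = 0" "h 1 = 0"
    and U: "uniform_limit {0..1} (\<lambda>n. u (r n)) \<phi> sequentially"
      "uniform_limit {0..1} (\<lambda>n. D01 (u (r n))) h sequentially"
    by (rule compactness[OF lu(4)])
  have \<phi>_cont: "continuous_on {0..1} \<phi>" using has_D01_continuous[OF h(1)] .
  \<comment> \<open>The normalisation \<open>N (u n) = 1\<close> passes to the uniform limit, so
    \<phi> cannot vanish identically.\<close>
  have "\<exists>x\<in>{0..1}. \<phi> x \<noteq> 0"
  proof (rule ccontr)
    assume "\<not> (\<exists>x\<in>{0..1}. \<phi> x \<noteq> 0)"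
    then have "integral {0..1} (\<lambda>x. \<phi> x * \<phi> x) = integral {0..1} (\<lambda>x::real. 0::real)"
      by (intro integral_cong) auto
    moreover have "bounded (\<phi> ` {0..1})"
      by (intro compact_imp_bounded compact_continuous_image \<phi>_cont) auto
    then have "uniform_limit {0..1} (\<lambda>n x. u (r n) x * u (r n) x) (\<lambda>x. \<phi> x * \<phi> x) sequentially"
      by (intro uniform_lim_mult U)
    then have "(\<lambda>n. integral {0..1} (\<lambda>x. u (r n) x * u (r n) x)) \<longlonglongrightarrow> integral {0..1} (\<lambda>x. \<phi> x * \<phi> x)"
      by (rule tendsto_integral_uniform_limit) (intro continuous_intros clampedD(3)[OF lu(4)])
    then have "integral {0..1} (\<lambda>x. \<phi> x * \<phi> x) = 1"
      using lu(6) by (simp add: N_def LIMSEQ_const_iff)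
    ultimately show False by simp
  qed
  moreover have "integral {0..1} (\<lambda>x. - (s * \<mu>) * h x * \<psi>3 x + a s x * h x * \<psi>1 x + b s x * \<phi> x * \<psi> x) = 0"
    if \<psi>: "has_D01 \<psi> \<psi>1" "has_D01 \<psi>1 \<psi>2" "has_D01 \<psi>2 \<psi>3" "continuous_on {0..1} \<psi>3"
      "\<psi> 0 = 0" "\<psi> 1 = 0" "\<psi>1 0 = 0" "\<psi>1 1 = 0" for \<psi> \<psi>1 \<psi>2 \<psi>3
  proof -
    have cl: "clamped \<psi>"
      using clampedI[OF \<psi>(1,2) has_D01_continuous[OF \<psi>(3)] \<psi>(5-8)] .
    \<comment> \<open>By the Cauchy-Schwarz inequality the square of the pairing with \<psi> is at
      most \<open>Q s (u (r n)) * (Q s \<psi> + 1)\<close>, which tends to 0. Uniqueness of limits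
      then gives the weak equation.\<close>
    have "(\<lambda>n. form (s * \<mu>) (a s) (b s) (u (r n)) \<psi>) \<longlonglongrightarrow> 0"
    proof -
      have "(\<lambda>n. Q s (u (r n)) * (Q s \<psi> + 1)) \<longlonglongrightarrow> 0"
        using tendsto_mult_left_zero[OF LIMSEQ_subseq_LIMSEQ[OF Q_lim r]] by (simp add: o_def)
      from tendsto_real_sqrt[OF this]
      have lim: "(\<lambda>n. sqrt (Q s (u (r n)) * (Q s \<psi> + 1))) \<longlonglongrightarrow> 0" by simp
      have bound: "norm (form (s * \<mu>) (a s) (b s) (u (r n)) \<psi>) \<le> sqrt (Q s (u (r n)) * (Q s \<psi> + 1))" for n
        using form_Cauchy_Schwarz[OF Qs[unfolded Q_def] lu(4) cl cont_ab, of "r n"]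
        by (simp add: Q_def real_le_rsqrt)
      show ?thesis
        by (rule Lim_null_comparison[OF always_eventually lim]) (use bound in blast)
    qed
    from LIMSEQ_unique[OF form_weak_limit[OF lu(4) h(2) \<phi>_cont U cont_ab \<psi>(1-4), of "s * \<mu>"] this]
    show ?thesis .
  qed
  ultimately show thesis unfolding a_def b_def by (intro that[OF s h])
qed

section \<open>Test functions with negative energy\<close>

text \<open>The bridge between the two notions of integral: the critical numbers use Lebesgue
  integrals over the open interval, the forms use gauge integrals over the closed one.\<close>

lemma continuous_int_I:
  fixes f :: "real \<Rightarrow> real"
  assumes "continuous_on {0..1} f"
  shows "integrable (lebesgue_on {0<..<1}) f" "int_I f = integral {0..1} f"
proof -
  have "f absolutely_integrable_on {0..1}"
    using assms by (rule absolutely_integrable_continuous_real)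
  then have "f absolutely_integrable_on {0<..<1}"
    by (rule set_integrable_subset) auto
  then show i: "integrable (lebesgue_on {0<..<1}) f"
    by (simp add: integrable_restrict_space set_integrable_def)
  show "int_I f = integral {0..1} f"
    using lebesgue_integral_eq_integral[OF i] by (simp add: integral_open_interval_real)
qed

lemma integrable_continuous_mult:
  fixes c f :: "real \<Rightarrow> real"
  assumes "continuous_on {0..1} c" "integrable (lebesgue_on {0<..<1}) f"
  shows "integrable (lebesgue_on {0<..<1}) (\<lambda>x. c x * f x)"
proof -
  have "compact (c ` {0..1})"
    using assms(1) by (intro compact_continuous_image) auto
  then obtain B where B: "\<forall>x\<in>{0..1}. \<bar>c x\<bar> \<le> B"
    using compact_imp_bounded[of "c ` {0..1}"] unfolding bounded_iff by auto
  have "continuous_on {0<..<1} c" by (rule continuous_on_subset[OF assms(1)]) auto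
  then have m: "c \<in> borel_measurable (lebesgue_on {0<..<1})"
    by (rule continuous_imp_measurable_on_sets_lebesgue) auto
  show ?thesis
  proof (rule Bochner_Integration.integrable_bound)
    show "integrable (lebesgue_on {0<..<1}) (\<lambda>x. B * f x)" using assms(2) by simp
    show "(\<lambda>x. c x * f x) \<in> borel_measurable (lebesgue_on {0<..<1})"
      using m assms(2) by measurable
    show "AE x in lebesgue_on {0<..<1}. norm (c x * f x) \<le> norm (B * f x)"
    proof (rule AE_I2)
      fix x :: real assume "x \<in> space (lebesgue_on {0<..<1})"
      then have "x \<in> {0..1}" by simp
      then have "\<bar>c x\<bar> \<le> \<bar>B\<bar>" using B abs_ge_self order_trans by blast
      then show "norm (c x * f x) \<le> norm (B * f x)"
        by (simp add: abs_mult mult_right_mono)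
    qed
  qed
qed

text \<open>A test function vanishes in neighbourhoods of 0 and 1, hence so does its derivative; and
  derivatives on the whole line restrict to derivatives within the interval.\<close>

lemma test_fun_clamped:
  assumes "test_fun \<psi>"
  shows "clamped \<psi>" "\<And>x. x \<in> {0..1} \<Longrightarrow> D01 \<psi> x = deriv_on UNIV \<psi> x"
    "continuous_on {0..1} (deriv_on UNIV \<psi>)"
proof -
  from assms obtain a b where s: "smooth_on UNIV \<psi>" and ab: "0 < a" "b < 1"
    "\<And>x. x \<notin> {a..b} \<Longrightarrow> \<psi> x = 0" by (auto simp: test_fun_def)
  let ?d = "deriv_on UNIV \<psi>"
  have d: "(\<psi> has_vector_derivative ?d x) (at x)" for x
    using smooth_on_has_vector_derivative[OF s] by simp
  have s1: "smooth_on UNIV ?d" using smooth_on_deriv[OF s] .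
  have has: "has_D01 f (deriv_on UNIV f)" if "smooth_on UNIV f" for f :: "real \<Rightarrow> real"
    using smooth_on_has_vector_derivative[OF that]
    by (simp add: has_D01_def has_vector_derivative_at_within)
  have zero: "\<psi> x = 0 \<and> ?d x = 0" if "x = 0 \<or> x = 1" for x
  proof
    show "\<psi> x = 0" using that ab by auto
    have "(\<psi> has_vector_derivative 0) (at x)"
    proof (rule has_vector_derivative_transform_within_open)
      show "((\<lambda>x. 0 :: real) has_vector_derivative 0) (at x)" by simp
      show "open (- {a..b})" by auto
      show "x \<in> - {a..b}" using that ab by auto
    qed (use ab in auto)
    then show "?d x = 0" using d vector_derivative_unique_at by blast
  qed
  have c2: "continuous_on {0..1} (deriv_on UNIV ?d)"
    using has_D01_continuous[OF has[OF smooth_on_deriv[OF s1]]] .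
  show "clamped \<psi>"
    by (rule clampedI[OF has[OF s] has[OF s1] c2]) (use zero in auto)
  show "x \<in> {0..1} \<Longrightarrow> D01 \<psi> x = ?d x" for x by (rule D01_eq[OF has[OF s]])
  show "continuous_on {0..1} ?d" using has_D01_continuous[OF has[OF s1]] .
qed

text \<open>Young's inequality for the mixed term of \<open>(y + (x - y))^2\<close>. Quadratic
  integrals of \<psi> and \<open>v\<close> thus differ by a small relative error plus a multiple of
  their squared distance.\<close>

lemma square_sum_bounds:
  fixes x y e :: real
  assumes "e > 0"
  shows "(1 - e) * y\<^sup>2 - (1 / e) * (x - y)\<^sup>2 \<le> x\<^sup>2"
    "x\<^sup>2 \<le> (1 + e) * y\<^sup>2 + (1 + 1 / e) * (x - y)\<^sup>2"
proof -
  define d where "d = x - y"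
  have x: "x = y + d" by (simp add: d_def)
  have "0 \<le> e * (y + d / e)\<^sup>2" "0 \<le> e * (y - d / e)\<^sup>2" using assms by simp_all
  moreover have "e * (y + d / e)\<^sup>2 = e * y\<^sup>2 + 2 * (y * d) + 1 / e * d\<^sup>2"
    "e * (y - d / e)\<^sup>2 = e * y\<^sup>2 - 2 * (y * d) + 1 / e * d\<^sup>2"
    using assms by (simp_all add: field_simps power2_eq_square)
  moreover have "(y + d)\<^sup>2 = y\<^sup>2 + 2 * (y * d) + d\<^sup>2" by (simp add: power2_sum)
  moreover have "0 \<le> d\<^sup>2" by simp
  ultimately show "(1 - e) * y\<^sup>2 - (1 / e) * (x - y)\<^sup>2 \<le> x\<^sup>2"
    "x\<^sup>2 \<le> (1 + e) * y\<^sup>2 + (1 + 1 / e) * (x - y)\<^sup>2"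
    unfolding d_def[symmetric] unfolding x left_diff_distrib distrib_right by linarith+
qed

text \<open>A Sobolev function whose quotient exceeds \<sigma> exists by definition of the supremum.
  The strict inequality survives approximation by test functions, and for these the form equals
  \<open>- k^2 (g X - \<sigma> Y)\<close>.\<close>

lemma unstable_test_function:
  assumes \<rho>: "smooth_on {0..1} \<rho>" "\<forall>x\<in>{0..1}. D01 \<rho> x > 0"
    and g: "g > 0" and \<sigma>: "\<sigma> > 0" "ereal \<sigma> < sigma_crit_k g \<rho> k" and k: "k \<noteq> 0"
  obtains f where "clamped f"
    "form 0 (\<lambda>x. \<sigma> * k\<^sup>2 * (D01 \<rho> x)\<^sup>2) (\<lambda>x. - (g * k\<^sup>2 * D01 \<rho> x - \<sigma> * k ^ 4 * (D01 \<rho> x)\<^sup>2)) f f < 0"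
proof -
  define r where "r = D01 \<rho>"
  let ?W = "lebesgue_on {0<..<1::real}"
  have r_cont: "continuous_on {0..1} r"
    unfolding r_def using smooth_on_continuous[OF smooth_on_deriv[OF \<rho>(1)]] .
  have r_pos: "0 < r x" if "x \<in> {0..1}" for x using \<rho>(2) that by (simp add: r_def)
  have "\<exists>x\<in>{0..1}. \<forall>y\<in>{0..1}. r y \<le> r x"
    using r_cont by (intro continuous_attains_sup) auto
  then obtain M where M: "\<forall>x\<in>{0..1}. r x \<le> M" by blast
  define X where "X v = int_I (\<lambda>x. r x * (v x)\<^sup>2)" for v
  define Y where "Y v w = int_I (\<lambda>x. (r x)\<^sup>2 * (k\<^sup>2 * (v x)\<^sup>2 + (w x)\<^sup>2))" for v w
  obtain v w where vw: "H01 v w" "\<sigma> < g * X v / Y v w"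
    using \<sigma>(2) unfolding sigma_crit_k_def less_Sup_iff H01_nonzero_def X_def Y_def r_def by auto
  from vw(1) have v: "v \<in> borel_measurable ?W" "integrable ?W (\<lambda>x. (v x)\<^sup>2)"
    and w: "w \<in> borel_measurable ?W" "integrable ?W (\<lambda>x. (w x)\<^sup>2)"
    by (auto simp: H01_def H1_def L2_I_def)
  from vw(1) obtain \<psi> where \<psi>: "\<And>n::nat. test_fun (\<psi> n)"
    and lim: "(\<lambda>n. int_I (\<lambda>x. (\<psi> n x - v x)\<^sup>2 + (deriv_on UNIV (\<psi> n) x - w x)\<^sup>2)) \<longlonglongrightarrow> 0"
    by (auto simp: H01_def)
  define \<psi>' where "\<psi>' n = deriv_on UNIV (\<psi> n)" for n
  have Y_nonneg: "0 \<le> Y v w" for v w unfolding Y_def by (rule Bochner_Integration.integral_nonneg) simp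
  have X_nonneg: "0 \<le> X v"
    unfolding X_def by (rule integral_nonneg_AE, rule AE_I2) (use r_pos in \<open>auto simp: less_imp_le\<close>)
  \<comment> \<open>Division by zero has value 0, which does not exceed the positive
    \<sigma>.\<close>
  have "Y v w \<noteq> 0" using vw(2) \<sigma>(1) by auto
  then have Y_pos: "0 < Y v w" using Y_nonneg[of v w] by simp
  define G where "G = g * X v - \<sigma> * Y v w"
  have G: "0 < G" using vw(2) Y_pos by (simp add: G_def pos_less_divide_eq)
  \<comment> \<open>Chosen so that the relative errors cost exactly half of the gap
    \<open>G\<close>.\<close>
  define e where "e = G / (2 * (g * X v + \<sigma> * Y v w))"
  have den: "0 < g * X v + \<sigma> * Y v w" using X_nonneg Y_pos g \<sigma>(1) by (simp add: add_nonneg_pos)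
  have e: "0 < e" using G den by (simp add: e_def)
  have e_half: "e * (g * X v + \<sigma> * Y v w) = G / 2"
    using den unfolding e_def by (metis divide_divide_eq_left less_irrefl nonzero_eq_divide_eq mult.commute)
  define i where "i = 1 / e"
  have i: "0 < i" using e by (simp add: i_def)
  note sq = square_sum_bounds[OF e, folded i_def]
  \<comment> \<open>The total coefficient of the squared H^1 distance in the estimates
    \<open>X_ge\<close> and \<open>Y_le\<close> below.\<close>
  define C where "C = g * (M * (i)) + \<sigma> * (M\<^sup>2 * (k\<^sup>2 + 1) * (1 + i))"
  have ex: "\<exists>n. 0 < g * X (\<psi> n) - \<sigma> * Y (\<psi> n) (\<psi>' n)"
  proof -
    define \<delta> where "\<delta> n = int_I (\<lambda>x. (\<psi> n x - v x)\<^sup>2 + (\<psi>' n x - w x)\<^sup>2)" for n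
    have "(\<lambda>n. C * \<delta> n) \<longlonglongrightarrow> 0"
      using tendsto_mult_right_zero[OF lim, of C] by (simp add: \<delta>_def \<psi>'_def)
    then have "\<forall>\<^sub>F n in sequentially. C * \<delta> n < G / 2"
      using G by (intro order_tendstoD(2)) auto
    then obtain n where n: "C * \<delta> n < G / 2" using eventually_happens by fastforce
    have cont: "continuous_on {0..1} (\<psi> n)" "continuous_on {0..1} (\<psi>' n)"
      using clampedD(3)[OF test_fun_clamped(1)[OF \<psi>]] test_fun_clamped(3)[OF \<psi>] by (auto simp: \<psi>'_def)
    have d_int: "integrable ?W (\<lambda>x. (p x - q x)\<^sup>2)"
      if "continuous_on {0..1} p" "q \<in> borel_measurable ?W" "integrable ?W (\<lambda>x. (q x)\<^sup>2)" for p q :: "real \<Rightarrow> real"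
    proof (rule Bochner_Integration.integrable_bound)
      show "integrable ?W (\<lambda>x. 2 * (p x)\<^sup>2 + 2 * (q x)\<^sup>2)"
        using that(3) continuous_int_I(1)[OF continuous_on_power[OF that(1)], of 2] by simp
      have "p \<in> borel_measurable ?W" using continuous_int_I(1)[OF that(1)] by simp
      then show "(\<lambda>x. (p x - q x)\<^sup>2) \<in> borel_measurable ?W" using that(2) by measurable
      have "(s - t)\<^sup>2 \<le> 2 * s\<^sup>2 + 2 * t\<^sup>2" for s t :: real
        using zero_le_power2[of "s + t"] unfolding power2_sum power2_diff by linarith
      then show "AE x in ?W. norm ((p x - q x)\<^sup>2) \<le> norm (2 * (p x)\<^sup>2 + 2 * (q x)\<^sup>2)" by simp
    qed
    note di = d_int[OF cont(1) v] d_int[OF cont(2) w]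
    have r2_cont: "continuous_on {0..1} (\<lambda>x. (r x)\<^sup>2)" by (intro continuous_intros r_cont)
    have Xi: "integrable ?W (\<lambda>x. r x * (v x)\<^sup>2)" by (rule integrable_continuous_mult[OF r_cont v(2)])
    have Yi: "integrable ?W (\<lambda>x. (r x)\<^sup>2 * (k\<^sup>2 * (v x)\<^sup>2 + (w x)\<^sup>2))"
      using v(2) w(2) by (intro integrable_continuous_mult[OF r2_cont]) auto
    \<comment> \<open>The distance of the derivatives is added only so that the error is measured by
      the same \<delta> as in \<open>Y_le\<close>.\<close>
    have X_ge: "(1 - e) * X v - M * (i) * \<delta> n \<le> X (\<psi> n)"
    proof -
      have "(1 - e) * X v - M * (i) * \<delta> n = int_I (\<lambda>x. (1 - e) * (r x * (v x)\<^sup>2)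
          - M * (i) * ((\<psi> n x - v x)\<^sup>2 + (\<psi>' n x - w x)\<^sup>2))"
        unfolding X_def \<delta>_def using Xi di by simp
      also have "\<dots> \<le> X (\<psi> n)"
        unfolding X_def
      proof (rule integral_mono)
        show "integrable ?W (\<lambda>x. r x * (\<psi> n x)\<^sup>2)"
          by (intro continuous_int_I continuous_intros r_cont cont)
        fix x assume "x \<in> space ?W"
        then have r: "0 < r x" "r x \<le> M" using r_pos M by auto
        have "r x * ((1 - e) * (v x)\<^sup>2 - (i) * (\<psi> n x - v x)\<^sup>2) \<le> r x * (\<psi> n x)\<^sup>2"
          using r sq(1) by (intro mult_left_mono) auto
        moreover have "r x * ((i) * (\<psi> n x - v x)\<^sup>2) \<le> M * ((i) * ((\<psi> n x - v x)\<^sup>2 + (\<psi>' n x - w x)\<^sup>2))"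
          using r i by (intro mult_mono mult_left_mono) auto
        ultimately show "(1 - e) * (r x * (v x)\<^sup>2) - M * (i) * ((\<psi> n x - v x)\<^sup>2 + (\<psi>' n x - w x)\<^sup>2)
            \<le> r x * (\<psi> n x)\<^sup>2"
          by (simp add: algebra_simps)
      qed (use Xi di in simp)
      finally show ?thesis .
    qed
    have Y_le: "Y (\<psi> n) (\<psi>' n) \<le> (1 + e) * Y v w + M\<^sup>2 * (k\<^sup>2 + 1) * (1 + i) * \<delta> n"
    proof -
      have "Y (\<psi> n) (\<psi>' n) \<le> int_I (\<lambda>x. (1 + e) * ((r x)\<^sup>2 * (k\<^sup>2 * (v x)\<^sup>2 + (w x)\<^sup>2))
          + M\<^sup>2 * (k\<^sup>2 + 1) * (1 + i) * ((\<psi> n x - v x)\<^sup>2 + (\<psi>' n x - w x)\<^sup>2))"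
        unfolding Y_def
      proof (rule integral_mono)
        show "integrable ?W (\<lambda>x. (r x)\<^sup>2 * (k\<^sup>2 * (\<psi> n x)\<^sup>2 + (\<psi>' n x)\<^sup>2))"
          by (intro continuous_int_I continuous_intros r_cont cont)
        fix x assume "x \<in> space ?W"
        then have "0 < r x" "r x \<le> M" using r_pos M by auto
        then have r: "0 \<le> (r x)\<^sup>2" "(r x)\<^sup>2 \<le> M\<^sup>2" by (auto intro: power_mono)
        define a where "a = (\<psi> n x - v x)\<^sup>2"
        define b where "b = (\<psi>' n x - w x)\<^sup>2"
        have ab: "0 \<le> a" "0 \<le> b" by (auto simp: a_def b_def)
        have "k\<^sup>2 * (\<psi> n x)\<^sup>2 + (\<psi>' n x)\<^sup>2
            \<le> k\<^sup>2 * ((1 + e) * (v x)\<^sup>2 + (1 + i) * a) + ((1 + e) * (w x)\<^sup>2 + (1 + i) * b)"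
          unfolding a_def b_def by (intro add_mono mult_left_mono sq(2)) auto
        also have "\<dots> = (1 + e) * (k\<^sup>2 * (v x)\<^sup>2 + (w x)\<^sup>2) + (1 + i) * (k\<^sup>2 * a + b)"
          by (simp add: algebra_simps)
        also have "\<dots> \<le> (1 + e) * (k\<^sup>2 * (v x)\<^sup>2 + (w x)\<^sup>2) + (1 + i) * ((k\<^sup>2 + 1) * (a + b))"
          using ab i by (intro add_left_mono mult_left_mono) (auto simp: algebra_simps)
        finally have "(r x)\<^sup>2 * (k\<^sup>2 * (\<psi> n x)\<^sup>2 + (\<psi>' n x)\<^sup>2) \<le>
            (r x)\<^sup>2 * ((1 + e) * (k\<^sup>2 * (v x)\<^sup>2 + (w x)\<^sup>2) + (1 + i) * ((k\<^sup>2 + 1) * (a + b)))"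
          using r(1) by (rule mult_left_mono)
        also have "\<dots> = (1 + e) * ((r x)\<^sup>2 * (k\<^sup>2 * (v x)\<^sup>2 + (w x)\<^sup>2))
            + (r x)\<^sup>2 * ((k\<^sup>2 + 1) * (1 + i) * (a + b))"
          by (simp add: algebra_simps)
        also have "\<dots> \<le> (1 + e) * ((r x)\<^sup>2 * (k\<^sup>2 * (v x)\<^sup>2 + (w x)\<^sup>2))
            + M\<^sup>2 * ((k\<^sup>2 + 1) * (1 + i) * (a + b))"
          using r ab i by (intro add_left_mono mult_right_mono) auto
        finally show "(r x)\<^sup>2 * (k\<^sup>2 * (\<psi> n x)\<^sup>2 + (\<psi>' n x)\<^sup>2) \<le> (1 + e) * ((r x)\<^sup>2 * (k\<^sup>2 * (v x)\<^sup>2 + (w x)\<^sup>2))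
            + M\<^sup>2 * (k\<^sup>2 + 1) * (1 + i) * ((\<psi> n x - v x)\<^sup>2 + (\<psi>' n x - w x)\<^sup>2)"
          by (simp add: a_def b_def mult.assoc)
      qed (use Yi di in simp)
      also have "\<dots> = (1 + e) * Y v w + M\<^sup>2 * (k\<^sup>2 + 1) * (1 + i) * \<delta> n"
        unfolding Y_def \<delta>_def using Yi di by simp
      finally show ?thesis .
    qed
    have "0 < G / 2 - C * \<delta> n" using n by simp
    also have "G / 2 - C * \<delta> n = G - e * (g * X v + \<sigma> * Y v w) - C * \<delta> n" using e_half by simp
    also have "\<dots> = g * ((1 - e) * X v - M * (i) * \<delta> n)
        - \<sigma> * ((1 + e) * Y v w + M\<^sup>2 * (k\<^sup>2 + 1) * (1 + i) * \<delta> n)"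
      unfolding G_def C_def left_diff_distrib right_diff_distrib distrib_left distrib_right by (simp add: mult_ac)
    also have "\<dots> \<le> g * X (\<psi> n) - \<sigma> * Y (\<psi> n) (\<psi>' n)"
      using g \<sigma>(1) by (intro diff_mono mult_left_mono X_ge Y_le) auto
    finally show ?thesis by blast
  qed
  then obtain n where n: "0 < g * X (\<psi> n) - \<sigma> * Y (\<psi> n) (\<psi>' n)" by blast
  have cont: "continuous_on {0..1} (\<psi> n)" "continuous_on {0..1} (\<psi>' n)"
    using clampedD(3)[OF test_fun_clamped(1)[OF \<psi>]] test_fun_clamped(3)[OF \<psi>] by (auto simp: \<psi>'_def)
  have "form 0 (\<lambda>x. \<sigma> * k\<^sup>2 * (D01 \<rho> x)\<^sup>2) (\<lambda>x. - (g * k\<^sup>2 * D01 \<rho> x - \<sigma> * k ^ 4 * (D01 \<rho> x)\<^sup>2)) (\<psi> n) (\<psi> n)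
    = integral {0..1} (\<lambda>x. (- k\<^sup>2 * g) * (r x * (\<psi> n x)\<^sup>2)
        + (k\<^sup>2 * \<sigma>) * ((r x)\<^sup>2 * (k\<^sup>2 * (\<psi> n x)\<^sup>2 + (\<psi>' n x)\<^sup>2)))"
    unfolding form_def
    by (rule integral_cong) (simp add: test_fun_clamped(2)[OF \<psi>] r_def \<psi>'_def algebra_simps power2_eq_square power4_eq_xxxx)
  also have "\<dots> = integral {0..1} (\<lambda>x. (- k\<^sup>2 * g) * (r x * (\<psi> n x)\<^sup>2))
     + (k\<^sup>2 * \<sigma>) * integral {0..1} (\<lambda>x. (r x)\<^sup>2 * (k\<^sup>2 * (\<psi> n x)\<^sup>2 + (\<psi>' n x)\<^sup>2))"
    by (intro integral_add_cmult continuous_intros r_cont cont)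
  also have "\<dots> = (- k\<^sup>2 * g) * X (\<psi> n) + (k\<^sup>2 * \<sigma>) * Y (\<psi> n) (\<psi>' n)"
  proof -
    have "X (\<psi> n) = integral {0..1} (\<lambda>x. r x * (\<psi> n x)\<^sup>2)"
      unfolding X_def by (intro continuous_int_I continuous_intros r_cont cont)
    moreover have "Y (\<psi> n) (\<psi>' n) = integral {0..1} (\<lambda>x. (r x)\<^sup>2 * (k\<^sup>2 * (\<psi> n x)\<^sup>2 + (\<psi>' n x)\<^sup>2))"
      unfolding Y_def by (intro continuous_int_I continuous_intros r_cont cont)
    ultimately show ?thesis by simp
  qed
  also have "\<dots> = - (k\<^sup>2 * (g * X (\<psi> n) - \<sigma> * Y (\<psi> n) (\<psi>' n)))"
    by (simp add: algebra_simps)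
  also have "\<dots> < 0" using n k by simp
  finally show thesis using that test_fun_clamped(1)[OF \<psi>] by blast
qed

section \<open>Normal modes\<close>

text \<open>Both trigonometric terms are kept so that the family is closed under partial
  derivatives: horizontal ones exchange the profiles up to factors, the vertical one differentiates
  them. The factor \<open>c\<close> will carry the growth in time.\<close>

definition wave :: "real \<Rightarrow> real \<Rightarrow> real \<Rightarrow> (real \<Rightarrow> real) \<Rightarrow> (real \<Rightarrow> real) \<Rightarrow> real ^ 3 \<Rightarrow> real"
  where "wave k1 k2 c A B x =
    c * (A (x $ 3) * cos (k1 * x $ 1 + k2 * x $ 2) + B (x $ 3) * sin (k1 * x $ 1 + k2 * x $ 2))"

lemma open_Omega: "open Omega"
proof -
  have "open ({x :: real ^ 3. x $ 3 > 0} \<inter> {x. x $ 3 < 1})"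
    by (intro open_Int open_halfspace_component_gt_cart open_halfspace_component_lt_cart)
  then show ?thesis by (simp add: Omega_def Collect_conj_eq)
qed

text \<open>The profiles are controlled only on [0,1], so derivative formulas hold only in the slab.
  As it is open, this is enough to substitute them inside a further derivative.\<close>

lemma has_derivative_cong_Omega:
  fixes f g :: "real ^ 3 \<Rightarrow> real"
  assumes "\<And>y. y \<in> Omega \<Longrightarrow> f y = g y" "x \<in> Omega"
  shows "(f has_derivative f') (at x) \<longleftrightarrow> (g has_derivative f') (at x)"
  using has_derivative_transform_within_open[OF _ open_Omega assms(2), of f f' UNIV g]
    has_derivative_transform_within_open[OF _ open_Omega assms(2), of g f' UNIV f] assms(1) by auto

lemma pd_cong_Omega:
  assumes "\<And>y. y \<in> Omega \<Longrightarrow> f y = g y" "x \<in> Omega"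
  shows "pd i f x = pd i g x"
  using has_derivative_cong_Omega[OF assms] by (simp add: pd_def frechet_derivative_def)

lemma differentiable_cong_Omega:
  fixes f g :: "real ^ 3 \<Rightarrow> real"
  assumes "\<And>y. y \<in> Omega \<Longrightarrow> f y = g y" "x \<in> Omega"
  shows "f differentiable (at x) \<longleftrightarrow> g differentiable (at x)"
  using has_derivative_cong_Omega[OF assms] by (simp add: differentiable_def)

lemma has_D01_cart_derivative:
  fixes A :: "real \<Rightarrow> real"
  assumes "has_D01 A A'" "x \<in> Omega"
  shows "((\<lambda>y :: real ^ 3. A (y $ 3)) has_derivative (\<lambda>v. v $ 3 * A' (x $ 3))) (at x)"
proof -
  have "(A has_derivative (\<lambda>h. h *\<^sub>R A' (x $ 3))) (at (x $ 3))"
    using has_D01_at[OF assms(1), of "x $ 3"] assms(2) by (simp add: Omega_def has_vector_derivative_def)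
  then have "(A \<circ> (\<lambda>y. y $ 3) has_derivative (\<lambda>h. h *\<^sub>R A' (x $ 3)) \<circ> (\<lambda>v. v $ 3)) (at x)"
    by (intro diff_chain_at) (auto intro: bounded_linear_imp_has_derivative bounded_linear_vec_nth)
  then show ?thesis by (simp add: o_def)
qed

lemma wave_has_derivative:
  assumes "has_D01 A A'" "has_D01 B B'" "x \<in> Omega"
  shows "(wave k1 k2 c A B has_derivative (\<lambda>v. wave k1 k2 c A' B' x * v $ 3
    + wave k1 k2 c B (\<lambda>z. - A z) x * (k1 * v $ 1 + k2 * v $ 2))) (at x)"
proof -
  let ?\<kappa> = "\<lambda>x :: real ^ 3. k1 * x $ 1 + k2 * x $ 2"
  have \<kappa>: "(?\<kappa> has_derivative ?\<kappa>) (at x)"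
    by (intro has_derivative_add has_derivative_mult_right bounded_linear_imp_has_derivative
        bounded_linear_vec_nth)
  show ?thesis
    unfolding wave_def[abs_def]
    by (rule has_derivative_eq_rhs)
      (rule has_derivative_mult_right has_derivative_add has_derivative_mult has_D01_cart_derivative
        has_derivative_cos has_derivative_sin \<kappa> assms | simp add: fun_eq_iff algebra_simps)+
qed

lemma wave_differentiable:
  assumes "has_D01 A A'" "has_D01 B B'" "x \<in> Omega"
  shows "wave k1 k2 c A B differentiable (at x)"
  using wave_has_derivative[OF assms] by (auto simp: differentiable_def)

lemma wave_pd:
  assumes "has_D01 A A'" "has_D01 B B'" "x \<in> Omega"
  shows "pd 1 (wave k1 k2 c A B) x = wave k1 k2 c (\<lambda>z. k1 * B z) (\<lambda>z. - k1 * A z) x"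
    "pd 2 (wave k1 k2 c A B) x = wave k1 k2 c (\<lambda>z. k2 * B z) (\<lambda>z. - k2 * A z) x"
    "pd 3 (wave k1 k2 c A B) x = wave k1 k2 c A' B' x"
  by (simp_all add: pd_def axis_def flip: frechet_derivative_at[OF wave_has_derivative[OF assms]])
    (simp_all add: wave_def algebra_simps)

lemma wave_pd_cases:
  assumes "has_D01 A A1" "has_D01 A1 A2" "has_D01 B B1" "has_D01 B1 B2"
  obtains P P' Q Q' where "has_D01 P P'" "has_D01 Q Q'"
    "\<And>x. x \<in> Omega \<Longrightarrow> pd i (wave k1 k2 c A B) x = wave k1 k2 c P Q x"
  using exhaust_3[of i]
  by (elim disjE)
    (use that[OF has_D01_cmult[OF assms(3), of k1] has_D01_cmult[OF assms(1), of "- k1"]]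
      that[OF has_D01_cmult[OF assms(3), of k2] has_D01_cmult[OF assms(1), of "- k2"]]
      that[OF assms(2,4)] wave_pd[OF assms(1,3)] in \<open>auto\<close>)

lemma wave_twice_diff:
  assumes "has_D01 A A1" "has_D01 A1 A2" "has_D01 B B1" "has_D01 B1 B2"
  shows "twice_diff_on_Omega (wave k1 k2 c A B)"
  unfolding twice_diff_on_Omega_def
proof (intro ballI conjI allI)
  fix x i assume x: "x \<in> Omega"
  show "wave k1 k2 c A B differentiable (at x)" by (rule wave_differentiable[OF assms(1,3) x])
  obtain P P' Q Q' where PQ: "has_D01 P P'" "has_D01 Q Q'"
    "\<And>x. x \<in> Omega \<Longrightarrow> pd i (wave k1 k2 c A B) x = wave k1 k2 c P Q x"
    using wave_pd_cases[OF assms] by blast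
  show "pd i (wave k1 k2 c A B) differentiable (at x)"
    using differentiable_cong_Omega[OF PQ(3) x] wave_differentiable[OF PQ(1,2) x] by simp
qed

lemma wave_lapl:
  assumes "has_D01 A A1" "has_D01 A1 A2" "has_D01 B B1" "has_D01 B1 B2" "x \<in> Omega"
  shows "lapl (wave k1 k2 c A B) x
    = wave k1 k2 c (\<lambda>z. A2 z - (k1\<^sup>2 + k2\<^sup>2) * A z) (\<lambda>z. B2 z - (k1\<^sup>2 + k2\<^sup>2) * B z) x"
proof -
  note w = wave_pd[OF assms(1,3)]
  have "pd 1 (pd 1 (wave k1 k2 c A B)) x = wave k1 k2 c (\<lambda>z. k1 * (- k1 * A z)) (\<lambda>z. - k1 * (k1 * B z)) x"
    by (subst pd_cong_Omega[OF w(1) assms(5)])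
      (simp_all only: wave_pd[OF has_D01_cmult[OF assms(3)] has_D01_cmult[OF assms(1)] assms(5)])
  moreover have "pd 2 (pd 2 (wave k1 k2 c A B)) x = wave k1 k2 c (\<lambda>z. k2 * (- k2 * A z)) (\<lambda>z. - k2 * (k2 * B z)) x"
    by (subst pd_cong_Omega[OF w(2) assms(5)])
      (simp_all only: wave_pd[OF has_D01_cmult[OF assms(3)] has_D01_cmult[OF assms(1)] assms(5)])
  moreover have "pd 3 (pd 3 (wave k1 k2 c A B)) x = wave k1 k2 c A2 B2 x"
    by (subst pd_cong_Omega[OF w(3) assms(5)]) (simp_all only: wave_pd[OF assms(2,4,5)])
  ultimately show ?thesis
    by (simp add: lapl_def sum_3 wave_def power2_eq_square algebra_simps)
qed

lemma wave_continuous: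
  assumes "continuous_on {0..1} A" "continuous_on {0..1} B"
  shows "continuous_on Omega_closed (wave k1 k2 c A B)"
proof -
  have n: "continuous_on Omega_closed (\<lambda>x :: real ^ 3. x $ i)" for i
    by (intro linear_continuous_on bounded_linear_vec_nth)
  have "continuous_on Omega_closed (\<lambda>x :: real ^ 3. C (x $ 3))" if "continuous_on {0..1} C" for C :: "real \<Rightarrow> real"
    by (rule continuous_on_compose2[OF that n]) (auto simp: Omega_closed_def)
  then show ?thesis unfolding wave_def[abs_def] using assms
    by (intro continuous_on_mult continuous_on_add continuous_on_cos continuous_on_sin
        continuous_on_const n) auto
qed

text \<open>\<open>k1 L\<close> and \<open>k2 L\<close> are integers, so a period shift changes the
  phase by an integer multiple of 2 pi.\<close>

lemma wave_periodic:
  assumes "k1 = of_int m / L" "k2 = of_int n / L" "L \<noteq> 0"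
  shows "wave k1 k2 c A B (x + axis 1 (2 * pi * L)) = wave k1 k2 c A B x"
    "wave k1 k2 c A B (x + axis 2 (2 * pi * L)) = wave k1 k2 c A B x"
proof -
  have per: "cos (y + 2 * pi * of_int j) = cos y" "sin (y + 2 * pi * of_int j) = sin y" for y :: real and j
    by (simp_all add: cos_add sin_add)
  have \<kappa>: "k1 * (x $ 1 + 2 * pi * L) + k2 * x $ 2 = (k1 * x $ 1 + k2 * x $ 2) + 2 * pi * of_int m"
    "k1 * x $ 1 + k2 * (x $ 2 + 2 * pi * L) = (k1 * x $ 1 + k2 * x $ 2) + 2 * pi * of_int n"
    using assms by (simp_all add: field_simps)
  have shift: "(x + axis 1 r) $ 1 = x $ 1 + r" "(x + axis 1 r) $ 2 = x $ 2" "(x + axis 1 r) $ 3 = x $ 3"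
    "(x + axis 2 r) $ 1 = x $ 1" "(x + axis 2 r) $ 2 = x $ 2 + r" "(x + axis 2 r) $ 3 = x $ 3" for r
    by (simp_all add: axis_def)
  show "wave k1 k2 c A B (x + axis 1 (2 * pi * L)) = wave k1 k2 c A B x"
    "wave k1 k2 c A B (x + axis 2 (2 * pi * L)) = wave k1 k2 c A B x"
    by (simp_all only: wave_def shift \<kappa> per)
qed

lemma wave_exp_derivative:
  "((\<lambda>s. wave k1 k2 (exp (l * s)) A B x) has_vector_derivative l * wave k1 k2 (exp (l * t)) A B x) (at t)"
  unfolding wave_def
  by (auto intro!: derivative_eq_intros simp flip: has_real_derivative_iff_has_vector_derivative)

text \<open>The horizontal velocity has profile \<open>(k1, k2) V\<close>, parallel to the wave
  vector. Both horizontal momentum equations therefore reduce to the same identity in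
  \<open>z\<close>, and the divergence to \<open>(k1^2 + k2^2) V + \<phi>1\<close>.\<close>

lemma normal_mode_solution:
  fixes \<rho> \<eta> V \<phi> p :: "real \<Rightarrow> real"
  assumes per: "k1 = of_int m / L" "k2 = of_int n / L" "L \<noteq> 0"
    and \<eta>: "has_D01 \<eta> \<eta>1" "has_D01 \<eta>1 \<eta>2" and V: "has_D01 V V1" "has_D01 V1 V2"
    and \<phi>: "has_D01 \<phi> \<phi>1" "has_D01 \<phi>1 \<phi>2" and p: "has_D01 p p1"
    and bc: "V 0 = 0" "V 1 = 0" "\<phi> 0 = 0" "\<phi> 1 = 0"
    and mass: "\<And>z. z \<in> {0..1} \<Longrightarrow> l * \<eta> z + D01 \<rho> z * \<phi> z = 0"
    and horizontal: "\<And>z. z \<in> {0..1} \<Longrightarrow> \<rho> z * (l * V z) - p z - \<mu> * (V2 z - (k1\<^sup>2 + k2\<^sup>2) * V z)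
      - \<sigma> * (D01 (D01 \<rho>) z * \<eta> z) = 0"
    and vertical: "\<And>z. z \<in> {0..1} \<Longrightarrow> \<rho> z * (l * \<phi> z) + p1 z - \<mu> * (\<phi>2 z - (k1\<^sup>2 + k2\<^sup>2) * \<phi> z)
      + \<sigma> * (D01 \<rho> z * (\<eta>2 z - (k1\<^sup>2 + k2\<^sup>2) * \<eta> z) + D01 (D01 \<rho>) z * \<eta>1 z) + g * \<eta> z = 0"
    and div0: "\<And>z. z \<in> {0..1} \<Longrightarrow> (k1\<^sup>2 + k2\<^sup>2) * V z + \<phi>1 z = 0"
  defines "Z \<equiv> \<lambda>z :: real. 0 :: real"
  shows "linearized_solution L g \<mu> \<sigma> \<rho> (\<lambda>t. wave k1 k2 (exp (l * t)) \<eta> Z)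
    (\<lambda>t x. \<chi> i. wave k1 k2 (exp (l * t)) (if i = 3 then \<phi> else Z)
      (\<lambda>z. (if i = 1 then k1 else if i = 2 then k2 else 0) * V z) x)
    (\<lambda>t. wave k1 k2 (exp (l * t)) p Z)"
proof -
  let ?A = "\<lambda>i :: 3. if i = 3 then \<phi> else Z"
  let ?B = "\<lambda>(i :: 3) z. (if i = 1 then k1 else if i = 2 then k2 else 0) * V z"
  let ?w = "\<lambda>t. wave k1 k2 (exp (l * t))"
  let ?u = "\<lambda>t x. \<chi> i. ?w t (?A i) (?B i) x"
  have Z: "has_D01 Z Z" unfolding Z_def by (rule has_D01_const)
  have A: "has_D01 (?A i) (if i = 3 then \<phi>1 else Z)" "has_D01 (if i = 3 then \<phi>1 else Z) (if i = 3 then \<phi>2 else Z)" for i :: 3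
    using \<phi> Z by auto
  have B: "has_D01 (?B i) (\<lambda>z. (if i = 1 then k1 else if i = 2 then k2 else 0) * V1 z)"
    "has_D01 (\<lambda>z. (if i = 1 then k1 else if i = 2 then k2 else 0) * V1 z)
      (\<lambda>z. (if i = 1 then k1 else if i = 2 then k2 else 0) * V2 z)" for i :: 3
    by (intro has_D01_cmult V)+
  have ui: "(\<lambda>y. ?u t y $ i) = ?w t (?A i) (?B i)" for t i by simp
  have z: "x $ 3 \<in> {0..1}" if "x \<in> Omega" for x using that by (auto simp: Omega_def)
  have du: "((\<lambda>s. ?u s x) has_vector_derivative (\<chi> i. l * ?w t (?A i) (?B i) x)) (at t)" for x t
  proof -
    have "((\<lambda>s. ?u s x $ i) has_vector_derivative l * ?w t (?A i) (?B i) x) (at t)" for i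
      using wave_exp_derivative by simp
    then show ?thesis
      unfolding has_vector_derivative_def
      by (subst has_derivative_componentwise_within)
        (simp add: Basis_vec_def inner_axis del: scaleR_conv_of_real)
  qed
  have momentum: "\<rho> (x $ 3) *\<^sub>R (\<chi> i. l * ?w t (?A i) (?B i) x) + grad (?w t p Z) x - \<mu> *\<^sub>R vec_lapl (?u t) x
      + \<sigma> *\<^sub>R ((D01 \<rho> (x $ 3) * lapl (?w t \<eta> Z) x) *\<^sub>R axis 3 1
      + D01 (D01 \<rho>) (x $ 3) *\<^sub>R grad (?w t \<eta> Z) x) + (g * ?w t \<eta> Z x) *\<^sub>R axis 3 1 = 0"
    if x: "x \<in> Omega" for x t
  proof -
    let ?z = "x $ 3" and ?c = "exp (l * t) * cos (k1 * x $ 1 + k2 * x $ 2)"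
      and ?s = "exp (l * t) * sin (k1 * x $ 1 + k2 * x $ 2)"
    let ?H = "\<rho> ?z * (l * V ?z) - p ?z - \<mu> * (V2 ?z - (k1\<^sup>2 + k2\<^sup>2) * V ?z) - \<sigma> * (D01 (D01 \<rho>) ?z * \<eta> ?z)"
    note pds = wave_pd[OF p Z x] wave_pd[OF \<eta>(1) Z x] wave_lapl[OF \<eta> Z Z x] wave_lapl[OF A B x]
    have 1: "\<rho> ?z * (l * ?w t (?A 1) (?B 1) x) + pd 1 (?w t p Z) x - \<mu> * lapl (?w t (?A 1) (?B 1)) x
       + \<sigma> * (D01 (D01 \<rho>) ?z * pd 1 (?w t \<eta> Z) x) = k1 * ?s * ?H"
      unfolding pds by (simp add: wave_def Z_def algebra_simps)
    have 2: "\<rho> ?z * (l * ?w t (?A 2) (?B 2) x) + pd 2 (?w t p Z) x - \<mu> * lapl (?w t (?A 2) (?B 2)) x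
       + \<sigma> * (D01 (D01 \<rho>) ?z * pd 2 (?w t \<eta> Z) x) = k2 * ?s * ?H"
      unfolding pds by (simp add: wave_def Z_def algebra_simps)
    have 3: "\<rho> ?z * (l * ?w t (?A 3) (?B 3) x) + pd 3 (?w t p Z) x - \<mu> * lapl (?w t (?A 3) (?B 3)) x
       + \<sigma> * (D01 \<rho> ?z * lapl (?w t \<eta> Z) x + D01 (D01 \<rho>) ?z * pd 3 (?w t \<eta> Z) x) + g * ?w t \<eta> Z x
       = ?c * (\<rho> ?z * (l * \<phi> ?z) + p1 ?z - \<mu> * (\<phi>2 ?z - (k1\<^sup>2 + k2\<^sup>2) * \<phi> ?z)
      + \<sigma> * (D01 \<rho> ?z * (\<eta>2 ?z - (k1\<^sup>2 + k2\<^sup>2) * \<eta> ?z) + D01 (D01 \<rho>) ?z * \<eta>1 ?z) + g * \<eta> ?z)"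
      unfolding pds by (simp add: wave_def Z_def algebra_simps)
    show ?thesis
      unfolding vec_eq_iff forall_3
      using 1 2 3 horizontal[OF z[OF x]] vertical[OF z[OF x]]
      by (simp add: grad_def vec_lapl_def ui axis_def)
  qed
  have div: "diverg (?u t) x = 0" if x: "x \<in> Omega" for x t
  proof -
    have "diverg (?u t) x = exp (l * t) * cos (k1 * x $ 1 + k2 * x $ 2) * ((k1\<^sup>2 + k2\<^sup>2) * V (x $ 3) + \<phi>1 (x $ 3))"
      unfolding diverg_def sum_3 ui wave_pd[OF A(1) B(1) x]
      by (simp add: wave_def Z_def power2_eq_square algebra_simps)
    then show ?thesis using div0[OF z[OF x]] by simp
  qed
  have d\<theta>: "l * ?w t \<eta> Z x + D01 \<rho> (x $ 3) * ?u t x $ 3 = 0" if x: "x \<in> Omega" for x t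
  proof -
    have "l * ?w t \<eta> Z x + D01 \<rho> (x $ 3) * ?u t x $ 3
      = exp (l * t) * cos (k1 * x $ 1 + k2 * x $ 2) * (l * \<eta> (x $ 3) + D01 \<rho> (x $ 3) * \<phi> (x $ 3))"
      by (simp add: wave_def Z_def algebra_simps)
    then show ?thesis using mass[OF z[OF x]] by simp
  qed
  show ?thesis
    unfolding linearized_solution_def
  proof (intro conjI allI ballI impI)
    fix t
    show "horizontally_periodic L (?w t \<eta> Z)" "horizontally_periodic L (?w t p Z)" "horizontally_periodic L (?u t)"
      by (simp_all add: horizontally_periodic_def wave_periodic[OF per])
    show "twice_diff_on_Omega (?w t \<eta> Z)" by (rule wave_twice_diff[OF \<eta> Z Z])
    show "twice_diff_on_Omega (\<lambda>x. ?u t x $ i)" for i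
      unfolding ui by (rule wave_twice_diff[OF A B])
    show "?w t p Z differentiable (at x)" if "x \<in> Omega" for x
      by (rule wave_differentiable[OF p Z that])
    show "continuous_on Omega_closed (?u t)"
      by (intro continuous_on_vec_lambda wave_continuous has_D01_continuous[OF A(1)] has_D01_continuous[OF B(1)])
  next
    fix t x assume x: "x \<in> Omega"
    show "(\<lambda>s. ?w s \<eta> Z x) differentiable (at t)"
      using wave_exp_derivative by (rule differentiableI_vector)
    show "(\<lambda>s. ?u s x) differentiable (at t)"
      using du by (rule differentiableI_vector)
    show "vector_derivative (\<lambda>s. ?w s \<eta> Z x) (at t) + D01 \<rho> (x $ 3) * ?u t x $ 3 = 0"
      unfolding vector_derivative_at[OF wave_exp_derivative] by (rule d\<theta>[OF x])
    show "\<rho> (x $ 3) *\<^sub>R vector_derivative (\<lambda>s. ?u s x) (at t) + grad (?w t p Z) x - \<mu> *\<^sub>R vec_lapl (?u t) x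
      + \<sigma> *\<^sub>R ((D01 \<rho> (x $ 3) * lapl (?w t \<eta> Z) x) *\<^sub>R axis 3 1
      + D01 (D01 \<rho>) (x $ 3) *\<^sub>R grad (?w t \<eta> Z) x) + (g * ?w t \<eta> Z x) *\<^sub>R axis 3 1 = 0"
      unfolding vector_derivative_at[OF du] by (rule momentum[OF x])
    show "diverg (?u t) x = 0" by (rule div[OF x])
  next
    fix t and x :: "real ^ 3" assume "x $ 3 = 0 \<or> x $ 3 = 1"
    then show "?u t x = 0" using bc by (auto simp: vec_eq_iff wave_def Z_def)
  qed
qed

section \<open>Characteristic values and the growing mode\<close>

lemma has_D01_D01:
  assumes "has_D01 f f1" "has_D01 f1 f2"
  shows "has_D01 (D01 f) f2"
  using assms has_D01_cong[of "D01 f" f1 f2 f2] D01_eq[OF assms(1)] by simp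

text \<open>Bootstrapping: if \<phi> and its first three derivatives are C^n, the equation makes the
  fourth one C^n, so each of the former is C^(n+1).\<close>

lemma linear_ode_smooth:
  fixes \<phi> p q r :: "real \<Rightarrow> real"
  assumes "has_D01 \<phi> \<phi>1" "has_D01 \<phi>1 \<phi>2" "has_D01 \<phi>2 \<phi>3" "has_D01 \<phi>3 \<phi>4"
    and eq: "\<And>x. x \<in> {0..1} \<Longrightarrow> \<phi>4 x = p x * \<phi> x + q x * \<phi>1 x + r x * \<phi>2 x"
    and smooth: "\<And>n. Cn n p" "\<And>n. Cn n q" "\<And>n. Cn n r"
  shows "Cn n \<phi>" "Cn n \<phi>1" "Cn n \<phi>2" "Cn n \<phi>3" "Cn n \<phi>4"
proof -
  let ?f = "\<lambda>x. p x * \<phi> x + q x * \<phi>1 x + r x * \<phi>2 x"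
  have step: "Cn n \<phi>4" if "Cn n \<phi>" "Cn n \<phi>1" "Cn n \<phi>2" for n
  proof -
    have "Cn n ?f" by (intro Cn_add Cn_mult smooth that)
    then show ?thesis using Cn_cong[of \<phi>4 ?f n] eq by simp
  qed
  have all: "Cn n \<phi> \<and> Cn n \<phi>1 \<and> Cn n \<phi>2 \<and> Cn n \<phi>3" for n
  proof (induction n)
    case 0
    then show ?case using assms(1-4) by (auto intro: has_D01_continuous)
  next
    case (Suc n)
    then have "Cn n \<phi>4" using step by blast
    with Suc assms(1-4) show ?case by auto
  qed
  then show "Cn n \<phi>" "Cn n \<phi>1" "Cn n \<phi>2" "Cn n \<phi>3" "Cn n \<phi>4" using step by blast+
qed

text \<open>The characteristic problem is posed for complex functions; a real eigenfunction is
  embedded by \<open>complex_of_real\<close>, which commutes with differentiation on the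
  interval.\<close>

lemma char_value_of_real:
  fixes \<phi> :: "real \<Rightarrow> real"
  assumes l: "0 < l" and \<phi>: "has_D01 \<phi> \<phi>1" "has_D01 \<phi>1 \<phi>2" "has_D01 \<phi>2 \<phi>3" "has_D01 \<phi>3 \<phi>4"
    and C4: "Cn 4 \<phi>" and \<rho>: "has_D01 \<rho> r1" "has_D01 r1 r2"
    and eq: "\<And>x. x \<in> {0..1} \<Longrightarrow>
      l\<^sup>2 * (k\<^sup>2 * \<rho> x * \<phi> x - (\<rho> x * \<phi>2 x + r1 x * \<phi>1 x))
      + l * (\<mu> * (\<phi>4 x - 2 * k\<^sup>2 * \<phi>2 x + k ^ 4 * \<phi> x))
      = g * k\<^sup>2 * r1 x * \<phi> x
      + \<sigma> * k\<^sup>2 * ((r1 x)\<^sup>2 * \<phi>2 x + 2 * r1 x * r2 x * \<phi>1 x) - \<sigma> * k ^ 4 * (r1 x)\<^sup>2 * \<phi> x"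
    and bc: "\<phi> 0 = 0" "\<phi> 1 = 0" "\<phi>1 0 = 0" "\<phi>1 1 = 0" and nz: "\<exists>x\<in>{0..1}. \<phi> x \<noteq> 0"
  shows "char_value g \<mu> \<sigma> \<rho> k (complex_of_real l)"
proof -
  let ?C = "\<lambda>(f :: real \<Rightarrow> real) x. complex_of_real (f x)"
  let ?\<Phi> = "?C \<phi>"
  note d = has_D01_of_real[OF \<phi>(1)] has_D01_of_real[OF \<phi>(2)] has_D01_of_real[OF \<phi>(3)]
    has_D01_of_real[OF \<phi>(4)]
  note dd = d(1) has_D01_D01[OF d(1,2)]
  note d3 = has_D01_D01[OF dd(2) d(3)]
  note d4 = has_D01_D01[OF d3 d(4)]
  have D: "D01 ?\<Phi> x = ?C \<phi>1 x" "(D01 ^^ 2) ?\<Phi> x = ?C \<phi>2 x" "(D01 ^^ 4) ?\<Phi> x = ?C \<phi>4 x"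
    if "x \<in> {0..1}" for x
    using D01_eq[OF dd(1) that] D01_eq[OF dd(2) that] D01_eq[OF d4 that]
    by (simp_all add: numeral_eq_Suc)
  have flux: "D01 (\<lambda>y. w y *\<^sub>R D01 ?\<Phi> y) x = complex_of_real (v x * \<phi>2 x + v' x * \<phi>1 x)"
    if "has_D01 v v'" "\<And>y. y \<in> {0..1} \<Longrightarrow> w y = v y" "x \<in> {0..1}" for v v' w x
  proof -
    have "D01 (\<lambda>y. w y *\<^sub>R D01 ?\<Phi> y) x = D01 (\<lambda>y. complex_of_real (v y * \<phi>1 y)) x"
      by (rule D01_cong) (use that D(1) in \<open>auto simp: scaleR_conv_of_real\<close>)
    also have "\<dots> = complex_of_real (v x * \<phi>2 x + v' x * \<phi>1 x)"
      by (rule D01_eq[OF has_D01_of_real[OF has_D01_mult[OF that(1) \<phi>(2)]] that(3)])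
    finally show ?thesis .
  qed
  have r1: "D01 \<rho> x = r1 x" if "x \<in> {0..1}" for x using D01_eq[OF \<rho>(1) that] .
  have "char_equation g \<mu> \<sigma> \<rho> k (complex_of_real l) ?\<Phi> x" if x: "x \<in> {0<..<1}" for x
  proof -
    have x': "x \<in> {0..1}" using x by auto
    have f1: "D01 (\<lambda>y. \<rho> y *\<^sub>R D01 ?\<Phi> y) x = complex_of_real (\<rho> x * \<phi>2 x + r1 x * \<phi>1 x)"
      by (rule flux[OF \<rho>(1) _ x']) simp
    have f2: "D01 (\<lambda>y. (D01 \<rho> y)\<^sup>2 *\<^sub>R D01 ?\<Phi> y) x
        = complex_of_real (r1 x * r1 x * \<phi>2 x + (r1 x * r2 x + r2 x * r1 x) * \<phi>1 x)"
      by (rule flux[OF has_D01_mult[OF \<rho>(2,2)] _ x']) (simp add: r1 power2_eq_square)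
    have "l\<^sup>2 * (k\<^sup>2 * \<rho> x * \<phi> x - (\<rho> x * \<phi>2 x + r1 x * \<phi>1 x))
      + l * (\<mu> * (\<phi>4 x - 2 * k\<^sup>2 * \<phi>2 x + k ^ 4 * \<phi> x))
      = g * k\<^sup>2 * r1 x * \<phi> x
      + \<sigma> * k\<^sup>2 * (r1 x * r1 x * \<phi>2 x + (r1 x * r2 x + r2 x * r1 x) * \<phi>1 x) - \<sigma> * k ^ 4 * (r1 x)\<^sup>2 * \<phi> x"
      using eq[OF x'] by (simp add: power2_eq_square algebra_simps)
    from arg_cong[OF this, of complex_of_real] show ?thesis
      unfolding char_equation_def f1 f2 D(2,3)[OF x'] r1[OF x']
      by (simp only: scaleR_conv_of_real of_real_add of_real_diff of_real_mult of_real_power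
          of_real_numeral mult.assoc)
  qed
  moreover have "C_k_on 4 {0..1} ?\<Phi>" by (intro C_k_onI Cn_of_real C4)
  ultimately show ?thesis
    unfolding char_value_def using l bc nz D(1)
    by (auto intro!: exI[of _ ?\<Phi>])
qed

text \<open>The critical parameter supplies a weak solution, regularity makes it C^4, and since
  \<open>l \<mu>\<close> is nonzero the equation can be solved for the fourth derivative, with
  smooth coefficients.\<close>

lemma eigenfunction_exists:
  assumes "g > 0" "\<mu> > 0" "smooth_on {0..1} \<rho>" "\<forall>x\<in>{0..1}. \<rho> x > 0" "\<forall>x\<in>{0..1}. D01 \<rho> x > 0"
    "0 < \<sigma>" "ereal \<sigma> < sigma_crit_k g \<rho> k" "k \<noteq> 0"
  defines "r1 \<equiv> D01 \<rho>" and "r2 \<equiv> D01 (D01 \<rho>)"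
  obtains l \<phi> \<phi>1 \<phi>2 \<phi>3 \<phi>4 where "0 < l" "has_D01 \<phi> \<phi>1" "has_D01 \<phi>1 \<phi>2" "has_D01 \<phi>2 \<phi>3" "has_D01 \<phi>3 \<phi>4"
    "\<And>n. Cn n \<phi>" "\<And>n. Cn n \<phi>1" "\<And>n. Cn n \<phi>2" "\<And>n. Cn n \<phi>3" "\<And>n. Cn n \<phi>4"
    "\<phi> 0 = 0" "\<phi> 1 = 0" "\<phi>1 0 = 0" "\<phi>1 1 = 0" "\<exists>x\<in>{0..1}. \<phi> x \<noteq> 0"
    "\<And>x. x \<in> {0..1} \<Longrightarrow>
      l\<^sup>2 * (k\<^sup>2 * \<rho> x * \<phi> x - (\<rho> x * \<phi>2 x + r1 x * \<phi>1 x))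
      + l * (\<mu> * (\<phi>4 x - 2 * k\<^sup>2 * \<phi>2 x + k ^ 4 * \<phi> x))
      = g * k\<^sup>2 * r1 x * \<phi> x
      + \<sigma> * k\<^sup>2 * ((r1 x)\<^sup>2 * \<phi>2 x + 2 * r1 x * r2 x * \<phi>1 x) - \<sigma> * k ^ 4 * (r1 x)\<^sup>2 * \<phi> x"
proof -
  have sm: "smooth_on {0..1} r1" "smooth_on {0..1} r2"
    unfolding r1_def r2_def by (intro smooth_on_deriv assms)+
  have Cn_r: "Cn n \<rho>" "Cn n r1" "Cn n r2" for n
    using smooth_on_Cn assms(3) sm by auto
  have d: "has_D01 \<rho> r1" "has_D01 r1 r2"
    using smooth_on_has_D01 assms(3) sm(1) by (auto simp: r1_def r2_def)
  define P where "P x = \<sigma> * k\<^sup>2 * (r1 x)\<^sup>2" for x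
  define S where "S x = g * k\<^sup>2 * r1 x - \<sigma> * k ^ 4 * (r1 x)\<^sup>2" for x
  have cont: "continuous_on {0..1} \<rho>" "continuous_on {0..1} P" "continuous_on {0..1} S"
    unfolding P_def[abs_def] S_def[abs_def]
    by (intro continuous_intros smooth_on_continuous[OF sm(1)] smooth_on_continuous[OF assms(3)])+
  obtain f where f: "clamped f" "form 0 P (\<lambda>x. - S x) f f < 0"
    by (rule unstable_test_function[OF assms(3,5,1,6,7,8), folded r1_def, folded P_def S_def])
  obtain l \<phi> \<phi>1 where l: "0 < l" and \<phi>1: "has_D01 \<phi> \<phi>1" "continuous_on {0..1} \<phi>1"
      "\<phi> 0 = 0" "\<phi> 1 = 0" "\<phi>1 0 = 0" "\<phi>1 1 = 0" and nz: "\<exists>x\<in>{0..1}. \<phi> x \<noteq> 0"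
    and weak: "\<And>\<psi> \<psi>1 \<psi>2 \<psi>3. \<lbrakk>has_D01 \<psi> \<psi>1; has_D01 \<psi>1 \<psi>2; has_D01 \<psi>2 \<psi>3; continuous_on {0..1} \<psi>3;
      \<psi> 0 = 0; \<psi> 1 = 0; \<psi>1 0 = 0; \<psi>1 1 = 0\<rbrakk> \<Longrightarrow>
      integral {0..1} (\<lambda>x. - (l * \<mu>) * \<phi>1 x * \<psi>3 x + (P x + l\<^sup>2 * \<rho> x + l * (2 * \<mu> * k\<^sup>2)) * \<phi>1 x * \<psi>1 x
        + (- S x + l\<^sup>2 * (k\<^sup>2 * \<rho> x) + l * (\<mu> * k ^ 4)) * \<phi> x * \<psi> x) = 0"
    by (rule critical_parameter[OF cont _ _ assms(2,8) f])
      (use assms(4,6) in \<open>auto simp: P_def\<close>)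
  define a where "a x = P x + l\<^sup>2 * \<rho> x + l * (2 * \<mu> * k\<^sup>2)" for x
  define a' where "a' x = \<sigma> * k\<^sup>2 * (r1 x * r2 x + r2 x * r1 x) + l\<^sup>2 * r1 x + 0" for x
  define b where "b x = - S x + l\<^sup>2 * (k\<^sup>2 * \<rho> x) + l * (\<mu> * k ^ 4)" for x
  have a: "has_D01 a a'"
    unfolding a_def[abs_def] a'_def[abs_def] P_def power2_eq_square[of "r1 _"]
    by (intro has_D01_add has_D01_cmult has_D01_mult has_D01_const d)
  have b: "continuous_on {0..1} b"
    unfolding b_def[abs_def] by (intro continuous_intros cont)
  have l\<mu>: "l * \<mu> \<noteq> 0" using l assms(2) by simp
  obtain \<phi>2 \<phi>3 \<phi>4 where \<phi>2: "has_D01 \<phi>1 \<phi>2" "has_D01 \<phi>2 \<phi>3" "has_D01 \<phi>3 \<phi>4"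
    and eq: "\<And>x. x \<in> {0..1} \<Longrightarrow> l * \<mu> * \<phi>4 x = a' x * \<phi>1 x + a x * \<phi>2 x - b x * \<phi> x"
    apply (rule weak_solution_regularity[OF l\<mu> \<phi>1 a b])
     apply (rule weak[folded a_def b_def]; assumption)
    subgoal premises prems by (rule prems(1)[OF prems(2-)])
    done
  have Cn_ab: "Cn n a" "Cn n a'" "Cn n b" for n
    unfolding a_def[abs_def] a'_def[abs_def] b_def[abs_def] P_def S_def power2_eq_square[of "r1 _"]
      diff_conv_add_uminus minus_mult_left minus_add_distrib minus_minus
    by (intro Cn_add Cn_cmult Cn_mult Cn_const Cn_r)+
  let ?i = "1 / (l * \<mu>)"
  have "\<phi>4 x = (- ?i * b x) * \<phi> x + (?i * a' x) * \<phi>1 x + (?i * a x) * \<phi>2 x" if "x \<in> {0..1}" for x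
  proof -
    have "\<phi>4 x = ?i * (l * \<mu> * \<phi>4 x)" using l\<mu> by simp
    then show ?thesis unfolding eq[OF that] by (simp only: algebra_simps)
  qed
  note smooth = linear_ode_smooth[OF \<phi>1(1) \<phi>2 this Cn_cmult[OF Cn_ab(3)] Cn_cmult[OF Cn_ab(2)] Cn_cmult[OF Cn_ab(1)]]
  show thesis
  proof (rule that[OF l \<phi>1(1) \<phi>2 smooth \<phi>1(3-6) nz])
    fix x :: real assume "x \<in> {0..1}"
    from eq[OF this] have "l * (\<mu> * \<phi>4 x) = a' x * \<phi>1 x + a x * \<phi>2 x - b x * \<phi> x" by simp
    then show "l\<^sup>2 * (k\<^sup>2 * \<rho> x * \<phi> x - (\<rho> x * \<phi>2 x + r1 x * \<phi>1 x))
      + l * (\<mu> * (\<phi>4 x - 2 * k\<^sup>2 * \<phi>2 x + k ^ 4 * \<phi> x))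
      = g * k\<^sup>2 * r1 x * \<phi> x
      + \<sigma> * k\<^sup>2 * ((r1 x)\<^sup>2 * \<phi>2 x + 2 * r1 x * r2 x * \<phi>1 x) - \<sigma> * k ^ 4 * (r1 x)\<^sup>2 * \<phi> x"
      unfolding a_def a'_def b_def P_def S_def by (simp add: algebra_simps)
  qed
qed

text \<open>With \<open>K = k\<^sup>2\<close> this is the vertical momentum equation after the pressure has been eliminated; the
  capillary terms collapse to the divergence form of the characteristic equation.\<close>

lemma vertical_momentum:
  fixes l K :: real
  assumes "l \<noteq> 0" "K \<noteq> 0"
    and eq: "l\<^sup>2 * (K * r0 * \<phi> - (r0 * \<phi>2 + r1 * \<phi>1)) + l * (\<mu> * (\<phi>4 - 2 * K * \<phi>2 + K\<^sup>2 * \<phi>))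
      = g * K * r1 * \<phi> + \<sigma> * K * (r1\<^sup>2 * \<phi>2 + 2 * r1 * r2 * \<phi>1) - \<sigma> * K\<^sup>2 * r1\<^sup>2 * \<phi>"
    and V: "K * V = - \<phi>1" "K * V1 = - \<phi>2" "K * V3 = - \<phi>4"
    and \<eta>: "l * \<eta> = - (r1 * \<phi>)" "l * \<eta>1 = - (r1 * \<phi>1 + r2 * \<phi>)"
      "l * \<eta>2 = - (r1 * \<phi>2 + 2 * r2 * \<phi>1 + r3 * \<phi>)"
  shows "r0 * (l * \<phi>) + (l * (r0 * V1 + r1 * V) - \<mu> * (V3 - K * V1) - \<sigma> * (r2 * \<eta>1 + r3 * \<eta>))
    - \<mu> * (\<phi>2 - K * \<phi>) + \<sigma> * (r1 * (\<eta>2 - K * \<eta>) + r2 * \<eta>1) + g * \<eta> = 0" (is "?E = 0")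
proof -
  \<comment> \<open>After multiplication by the nonzero \<open>K l\<close>, \<open>V\<close> and
    \<eta> enter only through products that the hypotheses express by \<phi>; the terms with
    \<open>r3\<close> cancel.\<close>
  have "K * l * ?E = K * l\<^sup>2 * r0 * \<phi> + l\<^sup>2 * (r0 * (K * V1) + r1 * (K * V)) - \<mu> * l * (K * V3 - K * (K * V1))
      - \<sigma> * K * (r2 * (l * \<eta>1) + r3 * (l * \<eta>)) - \<mu> * K * l * (\<phi>2 - K * \<phi>)
      + \<sigma> * K * (r1 * (l * \<eta>2 - K * (l * \<eta>)) + r2 * (l * \<eta>1)) + g * K * (l * \<eta>)"
    by (simp add: power2_eq_square algebra_simps)
  also have "\<dots> = 0"
    unfolding V \<eta> using eq by (simp add: power2_eq_square algebra_simps)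
  finally show ?thesis using assms(1,2) by simp
qed

theorem theorem2p2:
  fixes \<rho> :: "real \<Rightarrow> real" and g \<mu> L \<sigma> k1 k2 :: real
  assumes "g > 0" and "\<mu> > 0" and "L > 0"
    and "smooth_on {0..1} \<rho>"
    and "\<forall>x\<in>{0..1}. \<rho> x > 0"
    and "\<forall>x\<in>{0..1}. D01 \<rho> x > 0"
    and "0 < \<sigma>" and "ereal \<sigma> < sigma_crit g \<rho>"
    and "(k1, k2) \<in> unstable_freqs L g \<sigma> \<rho>"
  shows "\<exists>N lam. (N::nat) \<ge> 1 \<and>
    (\<forall>j\<in>{1..N}. char_value g \<mu> \<sigma> \<rho> (sqrt (k1\<^sup>2 + k2\<^sup>2)) (complex_of_real (lam j))) \<and>
    (\<forall>i\<in>{1..N}. \<forall>j\<in>{1..N}. i < j \<longrightarrow> lam i > lam j) \<and> lam N > 0 \<and>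
    (\<forall>j\<in>{1..N}. \<exists>\<theta> u q \<eta> v1 v2 \<phi> p.
       linearized_solution L g \<mu> \<sigma> \<rho> \<theta> u q \<and> nontrivial_fields \<theta> u \<and>
       smooth_on {0..1} (\<eta> :: real \<Rightarrow> real) \<and> smooth_on {0..1} (v1 :: real \<Rightarrow> real) \<and>
       smooth_on {0..1} (v2 :: real \<Rightarrow> real) \<and> smooth_on {0..1} (\<phi> :: real \<Rightarrow> real) \<and>
       smooth_on {0..1} (p :: real \<Rightarrow> real) \<and>
       (\<forall>t. \<forall>x\<in>Omega_closed.
          \<theta> t x     = exp (lam j * t) * cos (k1 * x $ 1 + k2 * x $ 2) * \<eta> (x $ 3) \<and>
          u t x $ 1 = exp (lam j * t) * sin (k1 * x $ 1 + k2 * x $ 2) * v1 (x $ 3) \<and>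
          u t x $ 2 = exp (lam j * t) * sin (k1 * x $ 1 + k2 * x $ 2) * v2 (x $ 3) \<and>
          u t x $ 3 = exp (lam j * t) * cos (k1 * x $ 1 + k2 * x $ 2) * \<phi> (x $ 3) \<and>
          q t x     = exp (lam j * t) * cos (k1 * x $ 1 + k2 * x $ 2) * p (x $ 3)))"
proof -
  define k where "k = sqrt (k1\<^sup>2 + k2\<^sup>2)"
  define K where "K = k1\<^sup>2 + k2\<^sup>2"
  obtain m n :: int where mn: "k1 = of_int m / L" "k2 = of_int n / L" "(k1, k2) \<noteq> (0, 0)"
    and \<sigma>k: "ereal \<sigma> < sigma_crit_k g \<rho> k"
    using assms(9) by (auto simp: unstable_freqs_def k_def)
  have K: "K \<noteq> 0" "k\<^sup>2 = K" "k ^ 4 = K\<^sup>2" "k \<noteq> 0"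
    using mn(3) by (auto simp: K_def k_def sum_power2_eq_zero_iff power4_eq_xxxx power2_eq_square
        simp flip: real_sqrt_mult)
  define r1 r2 r3 where "r1 = D01 \<rho>" and "r2 = D01 r1" and "r3 = D01 r2"
  obtain l \<phi> \<phi>1 \<phi>2 \<phi>3 \<phi>4 where l: "0 < l"
    and \<phi>: "has_D01 \<phi> \<phi>1" "has_D01 \<phi>1 \<phi>2" "has_D01 \<phi>2 \<phi>3" "has_D01 \<phi>3 \<phi>4"
    and Cn_\<phi>: "\<And>n. Cn n \<phi>" "\<And>n. Cn n \<phi>1" "\<And>n. Cn n \<phi>2" "\<And>n. Cn n \<phi>3" "\<And>n. Cn n \<phi>4"
    and bc: "\<phi> 0 = 0" "\<phi> 1 = 0" "\<phi>1 0 = 0" "\<phi>1 1 = 0" and nz: "\<exists>x\<in>{0..1}. \<phi> x \<noteq> 0"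
    and eq: "\<And>x. x \<in> {0..1} \<Longrightarrow>
      l\<^sup>2 * (k\<^sup>2 * \<rho> x * \<phi> x - (\<rho> x * \<phi>2 x + r1 x * \<phi>1 x))
      + l * (\<mu> * (\<phi>4 x - 2 * k\<^sup>2 * \<phi>2 x + k ^ 4 * \<phi> x))
      = g * k\<^sup>2 * r1 x * \<phi> x
      + \<sigma> * k\<^sup>2 * ((r1 x)\<^sup>2 * \<phi>2 x + 2 * r1 x * r2 x * \<phi>1 x) - \<sigma> * k ^ 4 * (r1 x)\<^sup>2 * \<phi> x"
    apply (rule eigenfunction_exists[OF assms(1,2,4-7) \<sigma>k K(4), folded r1_def, folded r2_def])
    subgoal premises prems by (rule prems(1)[OF prems(2-)])
    done
  have sm: "smooth_on {0..1} r1" "smooth_on {0..1} r2"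
    unfolding r1_def r2_def by (intro smooth_on_deriv assms)+
  have r: "has_D01 \<rho> r1" "has_D01 r1 r2" "has_D01 r2 r3"
    unfolding r1_def r2_def r3_def using smooth_on_has_D01 assms(4) sm[unfolded r1_def r2_def] by auto
  have Cn_r: "Cn n \<rho>" "Cn n r1" "Cn n r2" for n
    using smooth_on_Cn assms(4) sm by auto
  \<comment> \<open>The remaining profiles are forced: \<open>V\<close> by incompressibility, \<eta>
    by the transport equation, and \<open>p\<close> by horizontal momentum. Vertical momentum is
    then the characteristic equation.\<close>
  define V V1 V2 V3 where "V x = (- 1 / K) * \<phi>1 x" and "V1 x = (- 1 / K) * \<phi>2 x"
    and "V2 x = (- 1 / K) * \<phi>3 x" and "V3 x = (- 1 / K) * \<phi>4 x" for x
  have V: "has_D01 V V1" "has_D01 V1 V2" "has_D01 V2 V3"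
    unfolding V_def[abs_def] V1_def[abs_def] V2_def[abs_def] V3_def[abs_def] by (intro has_D01_cmult \<phi>)+
  define \<eta> \<eta>1 \<eta>2 where "\<eta> x = (- 1 / l) * (r1 x * \<phi> x)"
    and "\<eta>1 x = (- 1 / l) * (r1 x * \<phi>1 x + r2 x * \<phi> x)"
    and "\<eta>2 x = (- 1 / l) * ((r1 x * \<phi>2 x + r2 x * \<phi>1 x) + (r2 x * \<phi>1 x + r3 x * \<phi> x))" for x
  have \<eta>: "has_D01 \<eta> \<eta>1" "has_D01 \<eta>1 \<eta>2"
    unfolding \<eta>_def[abs_def] \<eta>1_def[abs_def] \<eta>2_def[abs_def]
    by (intro has_D01_cmult has_D01_add has_D01_mult \<phi> r)+
  define p where "p x = l * (\<rho> x * V x) - \<mu> * (V2 x - K * V x) - \<sigma> * (r2 x * \<eta> x)" for x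
  define p1 where "p1 x = l * (\<rho> x * V1 x + r1 x * V x) - \<mu> * (V3 x - K * V1 x)
    - \<sigma> * (r2 x * \<eta>1 x + r3 x * \<eta> x)" for x
  have p: "has_D01 p p1"
    unfolding p_def[abs_def] p1_def[abs_def]
    by (intro has_D01_cmult has_D01_add has_D01_diff has_D01_mult V \<eta> r)
  have Cn_V: "Cn n V" "Cn n V2" "Cn n \<eta>" for n
    unfolding V_def[abs_def] V2_def[abs_def] \<eta>_def[abs_def] by (intro Cn_cmult Cn_mult Cn_\<phi> Cn_r)+
  have Cn_p: "Cn n p" for n
    unfolding p_def[abs_def] by (intro Cn_cmult Cn_mult Cn_diff Cn_V Cn_r)
  let ?Z = "\<lambda>z :: real. 0 :: real"
  let ?\<theta> = "\<lambda>t. wave k1 k2 (exp (l * t)) \<eta> ?Z"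
  let ?u = "\<lambda>t x. \<chi> i :: 3. wave k1 k2 (exp (l * t)) (if i = 3 then \<phi> else ?Z)
      (\<lambda>z. (if i = 1 then k1 else if i = 2 then k2 else 0) * V z) x"
  let ?q = "\<lambda>t. wave k1 k2 (exp (l * t)) p ?Z"
  have sol: "linearized_solution L g \<mu> \<sigma> \<rho> ?\<theta> ?u ?q"
  proof (rule normal_mode_solution[OF mn(1,2) _ \<eta> V(1,2) \<phi>(1,2) p])
    show "L \<noteq> 0" "\<phi> 0 = 0" "\<phi> 1 = 0" "V 0 = 0" "V 1 = 0" using assms(3) bc by (auto simp: V_def)
    fix z :: real assume z: "z \<in> {0..1}"
    show "l * \<eta> z + D01 \<rho> z * \<phi> z = 0" using l by (simp add: \<eta>_def r1_def)
    show "(k1\<^sup>2 + k2\<^sup>2) * V z + \<phi>1 z = 0" using K(1) by (simp add: V_def flip: K_def)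
    show "\<rho> z * (l * V z) - p z - \<mu> * (V2 z - (k1\<^sup>2 + k2\<^sup>2) * V z) - \<sigma> * (D01 (D01 \<rho>) z * \<eta> z) = 0"
      by (simp add: p_def r1_def r2_def flip: K_def)
    show "\<rho> z * (l * \<phi> z) + p1 z - \<mu> * (\<phi>2 z - (k1\<^sup>2 + k2\<^sup>2) * \<phi> z)
      + \<sigma> * (D01 \<rho> z * (\<eta>2 z - (k1\<^sup>2 + k2\<^sup>2) * \<eta> z) + D01 (D01 \<rho>) z * \<eta>1 z) + g * \<eta> z = 0"
      unfolding K_def[symmetric] r1_def[symmetric] r2_def[symmetric] p1_def
      by (rule vertical_momentum[OF _ K(1) eq[OF z, unfolded K(2,3)]])
        (use l K(1) in \<open>simp_all add: V_def V1_def V3_def \<eta>_def \<eta>1_def \<eta>2_def\<close>)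
  qed
  have nontriv: "nontrivial_fields ?\<theta> ?u"
  proof -
    obtain z where z: "z \<in> {0..1}" "\<phi> z \<noteq> 0" using nz by blast
    then have "z \<noteq> 0" "z \<noteq> 1" using bc by auto
    \<comment> \<open>At the point (0, 0, z) and time 0 both the cosine and the exponential equal 1,
      so \<open>u3\<close> has the value \<phi>(z).\<close>
    then have "axis 3 z \<in> Omega" using z(1) by (simp add: Omega_def axis_def)
    moreover have "?u 0 (axis 3 z) $ 3 \<noteq> 0" using z(2) by (simp add: wave_def axis_def)
    then have "?u 0 (axis 3 z) \<noteq> 0" by (metis zero_index)
    ultimately show ?thesis unfolding nontrivial_fields_def by blast
  qed
  have cv: "char_value g \<mu> \<sigma> \<rho> k (complex_of_real l)"
    by (rule char_value_of_real[OF l \<phi> Cn_\<phi>(1) r(1,2) eq bc nz])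
  have modes: "\<forall>t. \<forall>x\<in>Omega_closed.
          ?\<theta> t x     = exp (l * t) * cos (k1 * x $ 1 + k2 * x $ 2) * \<eta> (x $ 3) \<and>
          ?u t x $ 1 = exp (l * t) * sin (k1 * x $ 1 + k2 * x $ 2) * (k1 * V (x $ 3)) \<and>
          ?u t x $ 2 = exp (l * t) * sin (k1 * x $ 1 + k2 * x $ 2) * (k2 * V (x $ 3)) \<and>
          ?u t x $ 3 = exp (l * t) * cos (k1 * x $ 1 + k2 * x $ 2) * \<phi> (x $ 3) \<and>
          ?q t x     = exp (l * t) * cos (k1 * x $ 1 + k2 * x $ 2) * p (x $ 3)"
    by (simp add: wave_def)
  have smooth: "smooth_on {0..1} \<eta>" "smooth_on {0..1} (\<lambda>x. k1 * V x)" "smooth_on {0..1} (\<lambda>x. k2 * V x)"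
    "smooth_on {0..1} \<phi>" "smooth_on {0..1} p"
    by (intro smooth_onI Cn_cmult Cn_V Cn_\<phi> Cn_p)+
  show ?thesis
  \<comment> \<open>With a single rate the ordering condition on the rates has no instances.\<close>
  proof (intro exI[of _ "1 :: nat"] exI[of _ "\<lambda>_. l"] conjI ballI impI)
    fix j :: nat
    show "\<exists>\<theta> u q \<eta> v1 v2 \<phi> p.
       linearized_solution L g \<mu> \<sigma> \<rho> \<theta> u q \<and> nontrivial_fields \<theta> u \<and>
       smooth_on {0..1} (\<eta> :: real \<Rightarrow> real) \<and> smooth_on {0..1} (v1 :: real \<Rightarrow> real) \<and>
       smooth_on {0..1} (v2 :: real \<Rightarrow> real) \<and> smooth_on {0..1} (\<phi> :: real \<Rightarrow> real) \<and>
       smooth_on {0..1} (p :: real \<Rightarrow> real) \<and>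
       (\<forall>t. \<forall>x\<in>Omega_closed.
          \<theta> t x     = exp (l * t) * cos (k1 * x $ 1 + k2 * x $ 2) * \<eta> (x $ 3) \<and>
          u t x $ 1 = exp (l * t) * sin (k1 * x $ 1 + k2 * x $ 2) * v1 (x $ 3) \<and>
          u t x $ 2 = exp (l * t) * sin (k1 * x $ 1 + k2 * x $ 2) * v2 (x $ 3) \<and>
          u t x $ 3 = exp (l * t) * cos (k1 * x $ 1 + k2 * x $ 2) * \<phi> (x $ 3) \<and>
          q t x     = exp (l * t) * cos (k1 * x $ 1 + k2 * x $ 2) * p (x $ 3))"
      by (intro exI conjI, rule sol, rule nontriv, rule smooth(1), rule smooth(2), rule smooth(3),
          rule smooth(4), rule smooth(5), rule modes)
  qed (use cv l in \<open>auto simp: k_def\<close>)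
qed

end
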